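(* Let $\{\mu_t\}_{t\ge0}$ be a weakly continuous boolean convolution semigroup with $\mu_0=\delta_0$, and let $\gamma\in\mathbb{R}$, $\tau$ positive finite be such that $K_{\mu_1}(z)=\gamma-\int_{\mathbb{R}}\frac{1+xz}{x-z}\,d\tau(x)$. The following are equivalent: (1) there exists $t_0>0$ such that $\operatorname{supp}\mu_{t_0}\subset[0,\infty)$; (2) $\operatorname{supp}\mu_t\subset[0,\infty)$ for all $0\le t<\infty$; (3) $\operatorname{supp}\tau\subset[0,\infty)$, $\tau(\{0\})=0$, $\int_0^\infty\frac1x\,d\tau(x)<\infty$ and $\gamma\ge\int_0^\infty\frac1x\,d\tau(x)$. In contrast, for free convolution semigroups condition (1) does not imply condition (2): there exists a weakly continuous free convolution semigroup $\{\mu_t\}_{t\ge0}$ with $\mu_0=\delta_0$ such that $\operatorname{supp}\mu_{t_0}\subset[0,\infty)$ for some $t_0>0$ but $\operatorname{supp}\mu_t\not\subset[0,\infty)$ for some $t>0$.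
   Context: For a probability measure $\mu$ on $\mathbb{R}$, $G_\mu(z)=\int\frac{1}{z-x}d\mu(x)$ on $\mathbb{C}^+$, $H_\mu=1/G_\mu$, and $K_\mu(z):=z-H_\mu(z)$, which has a unique representation $\gamma-\int\frac{1+xz}{x-z}d\tau(x)$. The boolean convolution $\mu\uplus\nu$ is characterized by $K_{\mu\uplus\nu}=K_\mu+K_\nu$. The Voiculescu transform $\phi_\mu(z):=H_\mu^{-1}(z)-z$ is defined on a region $\{|\operatorname{Re}z|<\eta|\operatorname{Im}z|,\ |\operatorname{Im}z|>M\}$ where $H_\mu$ has an analytic right inverse, and the free convolution $\mu\boxplus\nu$ is characterized by $\phi_{\mu\boxplus\nu}=\phi_\mu+\phi_\nu$. A weakly continuous boolean (resp. free) convolution semigroup is a weakly continuous family $\{\mu_t\}_{t\ge0}$ of probability measures with $\mu_s\uplus\mu_t=\mu_{s+t}$ (resp. $\mu_s\boxplus\mu_t=\mu_{s+t}$). *)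

theory Defs
  imports "HOL-Probability.Probability"
begin

definition prob_real :: "real measure \<Rightarrow> bool" where
  "prob_real M \<longleftrightarrow> real_distribution M"

definition msupp :: "real measure \<Rightarrow> real set" where
  "msupp M = {x. \<forall>e>0. emeasure M (ball x e) > 0}"

definition cauchy_G :: "real measure \<Rightarrow> complex \<Rightarrow> complex" where
  "cauchy_G M z = (\<integral>x. 1 / (z - complex_of_real x) \<partial>M)"

definition cauchy_H :: "real measure \<Rightarrow> complex \<Rightarrow> complex" where
  "cauchy_H M z = 1 / cauchy_G M z"

definition cauchy_K :: "real measure \<Rightarrow> complex \<Rightarrow> complex" where
  "cauchy_K M z = z - cauchy_H M z"

definition is_boolean_conv :: "real measure \<Rightarrow> real measure \<Rightarrow> real measure \<Rightarrow> bool" where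
  "is_boolean_conv \<mu> \<nu> \<rho> \<longleftrightarrow>
     (\<forall>z. Im z > 0 \<longrightarrow> cauchy_K \<rho> z = cauchy_K \<mu> z + cauchy_K \<nu> z)"

definition cone_region :: "real \<Rightarrow> real \<Rightarrow> complex set" where
  "cone_region \<eta> m = {z. \<bar>Re z\<bar> < \<eta> * Im z \<and> Im z > m}"

text \<open>F is an analytic right inverse of H_\<mu> on the region (the branch with F(z) = z + o(z)
  at infinity, which determines it uniquely); the Voiculescu transform is then F z - z.\<close>
definition H_right_inverse :: "real measure \<Rightarrow> (complex \<Rightarrow> complex) \<Rightarrow> real \<Rightarrow> real \<Rightarrow> bool" where
  "H_right_inverse \<mu> F \<eta> m \<longleftrightarrow>
     F holomorphic_on cone_region \<eta> m \<and>
     (\<forall>z\<in>cone_region \<eta> m. Im (F z) > 0 \<and> cauchy_H \<mu> (F z) = z) \<and>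
     ((\<lambda>z. (F z - z) / z) \<longlongrightarrow> 0) (at_infinity \<sqinter> principal (cone_region \<eta> m))"

definition voiculescu :: "(complex \<Rightarrow> complex) \<Rightarrow> complex \<Rightarrow> complex" where
  "voiculescu F z = F z - z"

definition is_free_conv :: "real measure \<Rightarrow> real measure \<Rightarrow> real measure \<Rightarrow> bool" where
  "is_free_conv \<mu> \<nu> \<rho> \<longleftrightarrow>
     (\<exists>\<eta>>0. \<exists>m>0. \<exists>F\<mu> F\<nu> F\<rho>.
        H_right_inverse \<mu> F\<mu> \<eta> m \<and> H_right_inverse \<nu> F\<nu> \<eta> m \<and> H_right_inverse \<rho> F\<rho> \<eta> m \<and>
        (\<forall>z\<in>cone_region \<eta> m. voiculescu F\<rho> z = voiculescu F\<mu> z + voiculescu F\<nu> z))"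

definition weakly_continuous_family :: "(real \<Rightarrow> real measure) \<Rightarrow> bool" where
  "weakly_continuous_family \<mu> \<longleftrightarrow>
     (\<forall>t\<ge>0. \<forall>s::nat \<Rightarrow> real. (\<forall>n. s n \<ge> 0) \<longrightarrow> s \<longlonglongrightarrow> t \<longrightarrow>
        weak_conv_m (\<lambda>n. \<mu> (s n)) (\<mu> t))"

definition boolean_semigroup :: "(real \<Rightarrow> real measure) \<Rightarrow> bool" where
  "boolean_semigroup \<mu> \<longleftrightarrow>
     (\<forall>t\<ge>0. prob_real (\<mu> t)) \<and> weakly_continuous_family \<mu> \<and>
     (\<forall>s\<ge>0. \<forall>t\<ge>0. is_boolean_conv (\<mu> s) (\<mu> t) (\<mu> (s + t)))"

definition free_semigroup :: "(real \<Rightarrow> real measure) \<Rightarrow> bool" where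
  "free_semigroup \<mu> \<longleftrightarrow>
     (\<forall>t\<ge>0. prob_real (\<mu> t)) \<and> weakly_continuous_family \<mu> \<and>
     (\<forall>s\<ge>0. \<forall>t\<ge>0. is_free_conv (\<mu> s) (\<mu> t) (\<mu> (s + t)))"

end

theory Submission
  imports Defs
begin

text \<open>Since \<open>K\<close> is additive and weakly continuous in \<open>t\<close>, \<open>H\<^bsub>\<mu>\<^sub>t\<^esub>(z) = z - t K\<^bsub>\<mu>\<^sub>1\<^esub>(z)\<close>. A finite
  measure vanishes on \<open>(-\<infinity>, 0)\<close> as soon as its Poisson integrals stay bounded near compact subsets
  of that half-line. If \<open>\<mu>\<^sub>t\<close> lives on \<open>[0, \<infinity>)\<close>, then \<open>-Re G\<close> is bounded below there, which bounds
  \<open>Im H / Im z\<close> and with it the Poisson integral of \<open>\<tau>\<close>; moreover \<open>Re H \<le> 0\<close>, and letting \<open>z\<close> tend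
  to \<open>0\<close> in \<open>t Re K(z) \<ge> Re z\<close> gives \<open>\<gamma> \<ge> \<integral> 1/x d\<tau>\<close> by Fatou. Conversely these conditions give
  \<open>Re K \<ge> 0\<close> on \<open>Re z < 0\<close>, so \<open>H\<close> is bounded away from zero and the Poisson integral of \<open>\<mu>\<^sub>t\<close> stays bounded,
  for every \<open>t\<close> at once.

  In the free case the semicircle laws of mean \<open>t\<close> and variance \<open>t\<close>, with \<open>\<phi>(z) = t + t/z\<close>, have
  support \<open>[t - 2\<surd>t, t + 2\<surd>t]\<close>, which lies in \<open>[0, \<infinity>)\<close> exactly when \<open>t = 0\<close> or \<open>t \<ge> 4\<close>.\<close>

subsection \<open>Poisson integrals and null sets\<close>

text \<open>Each negative point outside the support has a null ball around it; by Lindeloef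
  countably many of these balls already cover the negative half-line. Conversely, the ball of radius
  \<open>-x\<close> around a negative \<open>x\<close> stays among the negative numbers.\<close>

lemma msupp_subset_nonneg_iff:
  assumes M: "sets M = sets borel"
  shows "msupp M \<subseteq> {0..} \<longleftrightarrow> emeasure M {..<0} = 0"
proof
  assume supp: "msupp M \<subseteq> {0..}"
  define \<F> where "\<F> = {S. \<exists>x<0. \<exists>e>0. S = ball x e \<and> emeasure M (ball x e) = 0}"
  have "\<And>S. S \<in> \<F> \<Longrightarrow> open S" by (auto simp: \<F>_def)
  then obtain \<F>' where F': "\<F>' \<subseteq> \<F>" "countable \<F>'" "\<Union>\<F>' = \<Union>\<F>"
    by (rule Lindelof)
  have "{..<0} \<subseteq> \<Union>\<F>"
  proof
    fix x :: real assume "x \<in> {..<0}"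
    then have "x \<notin> msupp M" using supp by auto
    then obtain e where "e > 0" "emeasure M (ball x e) = 0"
      by (auto simp: msupp_def)
    then show "x \<in> \<Union>\<F>"
      using \<open>x \<in> {..<0}\<close> unfolding \<F>_def
      by (intro UnionI[of "ball x e"]) auto
  qed
  moreover have "(\<Union>S\<in>\<F>'. S) \<in> null_sets M"
    using F' M by (intro null_sets_UN') (auto simp: \<F>_def null_sets_def)
  ultimately have "{..<0} \<in> null_sets M"
    using F'(3) M by (auto intro: null_sets_subset)
  then show "emeasure M {..<0} = 0" by auto
next
  assume null: "emeasure M {..<0} = 0"
  show "msupp M \<subseteq> {0..}"
  proof (rule ccontr)
    assume "\<not> msupp M \<subseteq> {0..}"
    then obtain x where x: "x \<in> msupp M" "x < 0" by (meson atLeast_iff not_le subsetI)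
    have "emeasure M (ball x (-x)) \<le> emeasure M {..<0}"
      by (rule emeasure_mono) (auto simp: dist_real_def M)
    moreover have "emeasure M (ball x (-x)) > 0"
      using x unfolding msupp_def by simp
    ultimately show False
      using null by simp
  qed
qed

lemma AE_nonneg_if_null:
  fixes M :: "real measure"
  assumes "sets M = sets borel" "emeasure M {..<0} = 0"
  shows "AE x in M. 0 \<le> x"
  by (rule AE_I[of _ _ "{..<0}"]) (use assms in auto)

context finite_borel_measure
begin

declare M_is_borel [measurable_cong]

lemma integrable_cauchy_kernel:
  assumes "Im z > 0"
  shows "integrable M (\<lambda>x. 1 / (z - complex_of_real x))"
proof (rule integrable_const_bound[of _ "1 / Im z"])
  have "norm (1 / (z - complex_of_real x)) \<le> 1 / Im z" for x
    using abs_Im_le_cmod[of "z - complex_of_real x"] assms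
    by (simp add: norm_divide divide_simps)
  then show "AE x in M. norm (1 / (z - complex_of_real x)) \<le> 1 / Im z" by simp
qed measurable

lemma integrable_poisson_kernel:
  assumes "y > 0"
  shows "integrable M (\<lambda>x. 1 / ((x - u)\<^sup>2 + y\<^sup>2))"
proof (rule integrable_const_bound[of _ "1 / y\<^sup>2"])
  have "norm (1 / ((x - u)\<^sup>2 + y\<^sup>2)) \<le> 1 / y\<^sup>2" for x
    using assms by (auto intro!: divide_left_mono simp: add_nonneg_pos)
  then show "AE x in M. norm (1 / ((x - u)\<^sup>2 + y\<^sup>2)) \<le> 1 / y\<^sup>2" by simp
qed measurable

lemma Im_cauchy_G:
  assumes "Im z > 0"
  shows "Im (cauchy_G M z) = - Im z * (\<integral>x. 1 / ((x - Re z)\<^sup>2 + (Im z)\<^sup>2) \<partial>M)"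
proof -
  have "Im (cauchy_G M z) = (\<integral>x. Im (1 / (z - complex_of_real x)) \<partial>M)"
    unfolding cauchy_G_def using integrable_cauchy_kernel[OF assms] by simp
  also have "\<dots> = (\<integral>x. - Im z * (1 / ((x - Re z)\<^sup>2 + (Im z)\<^sup>2)) \<partial>M)"
    by (intro Bochner_Integration.integral_cong)
       (auto simp: Im_divide power2_commute)
  also have "\<dots> = - Im z * (\<integral>x. 1 / ((x - Re z)\<^sup>2 + (Im z)\<^sup>2) \<partial>M)"
    by (rule integral_mult_right_zero)
  finally show ?thesis .
qed

lemma Re_cauchy_G:
  assumes "Im z > 0"
  shows "integrable M (\<lambda>x. (x - Re z) / ((x - Re z)\<^sup>2 + (Im z)\<^sup>2))"
    and "- Re (cauchy_G M z) = (\<integral>x. (x - Re z) / ((x - Re z)\<^sup>2 + (Im z)\<^sup>2) \<partial>M)"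
proof -
  have eq: "Re (1 / (z - complex_of_real x)) = - ((x - Re z) / ((x - Re z)\<^sup>2 + (Im z)\<^sup>2))" for x
    by (subst minus_divide_left) (simp add: Re_divide power2_commute[of "Re z"])
  have int: "integrable M (\<lambda>x. Re (1 / (z - complex_of_real x)))"
    using integrable_cauchy_kernel[OF assms] by (rule integrable_Re)
  then show "integrable M (\<lambda>x. (x - Re z) / ((x - Re z)\<^sup>2 + (Im z)\<^sup>2))"
    unfolding eq by simp
  have "Re (cauchy_G M z) = (\<integral>x. Re (1 / (z - complex_of_real x)) \<partial>M)"
    unfolding cauchy_G_def using integrable_cauchy_kernel[OF assms] by simp
  then show "- Re (cauchy_G M z) = (\<integral>x. (x - Re z) / ((x - Re z)\<^sup>2 + (Im z)\<^sup>2) \<partial>M)"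
    unfolding eq by simp
qed

text \<open>A bound on the Poisson integral makes the mass of an interval of length \<open>h\<close> of order
  \<open>h\<^sup>2\<close>, so that subdividing \<open>{a..b}\<close> shows its mass to be zero.\<close>

lemma measure_interval_zero:
  assumes "a < b"
    and C: "\<And>u y. a \<le> u \<Longrightarrow> u \<le> b \<Longrightarrow> 0 < y \<Longrightarrow> y \<le> 1 \<Longrightarrow> (\<integral>x. 1 / ((x - u)\<^sup>2 + y\<^sup>2) \<partial>M) \<le> C"
  shows "emeasure M {a..b} = 0"
proof -
  \<comment> \<open>On this interval the Poisson kernel at height \<open>y\<close> is at least
    \<open>1 / (2 * y^2)\<close>, so the indicator is at most \<open>2 * y^2\<close> times the
    kernel.\<close>
  have local: "measure M {u - y..u + y} \<le> 2 * y\<^sup>2 * C"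
    if "a \<le> u" "u \<le> b" "0 < y" "y \<le> 1" for u y
  proof -
    have "measure M {u - y..u + y} = (\<integral>x. indicator {u - y..u + y} x \<partial>M)"
      by simp
    also have "\<dots> \<le> (\<integral>x. 2 * y\<^sup>2 * (1 / ((x - u)\<^sup>2 + y\<^sup>2)) \<partial>M)"
    proof (rule integral_mono)
      show "integrable M (\<lambda>x. 2 * y\<^sup>2 * (1 / ((x - u)\<^sup>2 + y\<^sup>2)))"
        using integrable_poisson_kernel[OF that(3), of u] by (rule integrable_mult_right)
      fix x
      have "(x - u)\<^sup>2 \<le> y\<^sup>2" if "x \<in> {u - y..u + y}"
        using that by (intro abs_le_square_iff[THEN iffD1]) auto
      moreover have "(x - u)\<^sup>2 + y\<^sup>2 > 0"
        using that by (simp add: add_nonneg_pos)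
      ultimately show "indicator {u - y..u + y} x \<le> 2 * y\<^sup>2 * (1 / ((x - u)\<^sup>2 + y\<^sup>2))"
        by (auto simp: indicator_def divide_simps)
    qed (simp add: M_is_borel integrable_real_indicator emeasure_finite less_top[symmetric])
    also have "\<dots> \<le> 2 * y\<^sup>2 * C"
      using C[OF that] by (subst integral_mult_right_zero) (intro mult_left_mono, auto)
    finally show ?thesis .
  qed
  \<comment> \<open>The requirement on \<open>n\<close> makes the mesh \<open>h\<close> at most 1,
    the range of heights in which \<open>C\<close> is available. The \<open>n\<close> pieces of mass
    \<open>O(h^2)\<close> then add up to \<open>O(1 / n)\<close>.\<close>
  have bound: "measure M {a..b} \<le> 2 * C * (b - a)\<^sup>2 / real n" if n: "real n > b - a" for n
  proof -
    define h where "h = (b - a) / real n"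
    have n0: "real n > 0" using n \<open>a < b\<close> by linarith
    have h: "0 < h" "h \<le> 1" "real n * h = b - a"
      using n n0 \<open>a < b\<close> by (auto simp: h_def)
    have cover: "{a..b} \<subseteq> (\<Union>k<n. {a + real k * h - h..a + real k * h + h})"
    proof
      fix x assume x: "x \<in> {a..b}"
      show "x \<in> (\<Union>k<n. {a + real k * h - h..a + real k * h + h})"
      proof (cases "x = b")
        \<comment> \<open>At the right endpoint the floor used below would give the index
          \<open>n\<close>, one too many; the interval around the last centre still reaches
          \<open>b\<close>.\<close>
        case True
        have "n > 0" using n0 by simp
        then show ?thesis
          using True h by (intro UN_I[of "n - 1"]) (auto simp: of_nat_diff algebra_simps)
      next
        case False
        define k where "k = nat \<lfloor>(x - a) / h\<rfloor>"
        have nn: "(x - a) / h \<ge> 0" using x h by auto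
        have k: "real k \<le> (x - a) / h" "(x - a) / h < real k + 1"
          using nn unfolding k_def by linarith+
        have "(x - a) / h < real n"
          using False x h by (simp add: pos_divide_less_eq)
        then have "k < n" using k(1) by linarith
        then show ?thesis
          using k h by (intro UN_I[of k]) (auto simp: field_simps)
      qed
    qed
    have "measure M {a..b} \<le> measure M (\<Union>k<n. {a + real k * h - h..a + real k * h + h})"
      by (rule finite_measure_mono[OF cover]) simp
    also have "\<dots> \<le> (\<Sum>k<n. measure M {a + real k * h - h..a + real k * h + h})"
      by (rule finite_measure_subadditive_finite) auto
    also have "\<dots> \<le> (\<Sum>k<n. 2 * h\<^sup>2 * C)"
    proof (rule sum_mono)
      fix k assume "k \<in> {..<n}"
      then have "real k * h \<le> real n * h" using h by (intro mult_right_mono) auto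
      then show "measure M {a + real k * h - h..a + real k * h + h} \<le> 2 * h\<^sup>2 * C"
        using h by (intro local) auto
    qed
    also have "\<dots> = 2 * C * (b - a)\<^sup>2 / real n"
      using n0 by (simp add: h_def power2_eq_square)
    finally show ?thesis .
  qed
  have "measure M {a..b} \<le> 0"
  proof (rule tendsto_lowerbound)
    show "(\<lambda>n. 2 * C * (b - a)\<^sup>2 / real n) \<longlonglongrightarrow> 0"
      by (rule lim_const_over_n)
    have "eventually (\<lambda>n. real n > b - a) sequentially"
      using filterlim_real_sequentially by (simp add: filterlim_at_top_dense)
    then show "eventually (\<lambda>n. measure M {a..b} \<le> 2 * C * (b - a)\<^sup>2 / real n) sequentially"
      by eventually_elim (rule bound)
  qed simp
  then show ?thesis
    by (simp add: emeasure_eq_measure measure_le_0_iff)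
qed

lemma null_negatives:
  assumes "\<And>a b. a < b \<Longrightarrow> b < 0 \<Longrightarrow>
    \<exists>C. \<forall>u\<in>{a..b}. \<forall>y\<in>{0<..1}. (\<integral>x. 1 / ((x - u)\<^sup>2 + y\<^sup>2) \<partial>M) \<le> C"
  shows "emeasure M {..<0} = 0"
proof -
  \<comment> \<open>These compact intervals exhaust the negative half-line, so the constant
    \<open>C\<close> may depend on the interval. The shift by 2 keeps the interval nondegenerate at
    \<open>n = 0\<close>.\<close>
  have "emeasure M {- real n - 2..- 1 / (real n + 1)} = 0" for n
  proof -
    have less: "- real n - 2 < - 1 / (real n + 1)" "- 1 / (real n + 1) < 0"
      by (auto simp: field_simps intro: add_pos_nonneg)
    show ?thesis
      using assms[OF less] measure_interval_zero[OF less(1)] by fastforce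
  qed
  then have "emeasure M (\<Union>n. {- real n - 2..- 1 / (real n + 1)}) = 0"
    by (intro emeasure_UN_eq_0) auto
  moreover have "{..<0} \<subseteq> (\<Union>n. {- real n - 2..- 1 / (real n + 1)})"
  proof
    fix x :: real assume "x \<in> {..<0}"
    then have x: "x < 0" by simp
    define n where "n = nat \<lceil>max (- x) (- 1 / x)\<rceil>"
    have "real n \<ge> max (- x) (- 1 / x)" unfolding n_def by linarith
    then show "x \<in> (\<Union>n. {- real n - 2..- 1 / (real n + 1)})"
      using x by (intro UN_I[of n]) (auto simp: field_simps)
  qed
  moreover have "(\<Union>n. {- real n - 2..- 1 / (real n + 1)}) \<in> sets M"
    unfolding M_is_borel by (intro sets.countable_UN) auto
  ultimately show ?thesis by (metis emeasure_eq_0)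
qed

end

subsection \<open>Boolean convolution semigroups\<close>

text \<open>The sign is chosen so that the imaginary part is nonnegative on the upper half-plane;
  \<open>K\<close> at time 1 is then \<open>\<gamma>\<close> minus this integral.\<close>

definition nevanlinna :: "real measure \<Rightarrow> complex \<Rightarrow> complex" where
  "nevanlinna \<tau> z = (\<integral>x. (1 + complex_of_real x * z) / (complex_of_real x - z) \<partial>\<tau>)"

text \<open>Splitting off the linear term leaves a multiple of the resolvent kernel. This gives
  integrability, and near \<open>z = 0\<close> it isolates the part that tends to
  \<open>1 / x\<close>.\<close>

lemma nevanlinna_kernel_eq:
  assumes "Im z > 0"
  shows "(1 + complex_of_real x * z) / (complex_of_real x - z)
    = z + (1 + z\<^sup>2) / (complex_of_real x - z)"
proof -
  have "complex_of_real x - z \<noteq> 0" using assms by (auto simp: complex_eq_iff)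
  then show ?thesis by (simp add: field_simps power2_eq_square)
qed

lemma Im_nevanlinna_kernel:
  assumes "Im z > 0"
  shows "Im ((1 + complex_of_real x * z) / (complex_of_real x - z))
    = Im z * ((1 + x\<^sup>2) / ((x - Re z)\<^sup>2 + (Im z)\<^sup>2))"
  by (simp add: Im_divide algebra_simps power2_eq_square)

text \<open>With \<open>z = u + i y\<close>, the difference of the two sides has numerator
  \<open>(1 + x^2) * (u^2 + y^2 - u * x)\<close>, which is nonnegative for
  \<open>u <= 0 < x\<close>. After integration this bound turns the condition on
  \<open>\<gamma>\<close> into a sign for the real part of \<open>K\<close>.\<close>

lemma Re_nevanlinna_kernel_le:
  assumes "Im z > 0" "Re z \<le> 0" "x > 0"
  shows "Re ((1 + complex_of_real x * z) / (complex_of_real x - z)) \<le> 1 / x"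
proof -
  define u y where "u = Re z" and "y = Im z"
  have pos: "(x - u)\<^sup>2 + y\<^sup>2 > 0" using assms by (intro add_nonneg_pos) (auto simp: y_def)
  have "1 / x - ((1 + x * u) * (x - u) - x * y * y) / ((x - u)\<^sup>2 + y\<^sup>2)
    = (1 + x\<^sup>2) * (u\<^sup>2 + y\<^sup>2 - u * x) / (x * ((x - u)\<^sup>2 + y\<^sup>2))"
  proof -
    define d where "d = (x - u)\<^sup>2 + y\<^sup>2"
    have "d > 0" using pos by (simp add: d_def)
    then have "1 / x - ((1 + x * u) * (x - u) - x * y * y) / d
        = (d - x * ((1 + x * u) * (x - u) - x * y * y)) / (x * d)"
      using assms by (simp add: field_simps)
    also have "d - x * ((1 + x * u) * (x - u) - x * y * y) = (1 + x\<^sup>2) * (u\<^sup>2 + y\<^sup>2 - u * x)"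
      unfolding d_def by (simp add: algebra_simps power2_eq_square)
    finally show ?thesis unfolding d_def .
  qed
  also have "\<dots> \<ge> 0"
  proof -
    have "u * x \<le> 0" using assms by (simp add: u_def mult_nonpos_nonneg)
    then have "u\<^sup>2 + y\<^sup>2 - u * x \<ge> 0" using zero_le_power2[of u] zero_le_power2[of y] by linarith
    then show ?thesis using pos assms by simp
  qed
  finally have "((1 + x * u) * (x - u) - x * y * y) / ((x - u)\<^sup>2 + y\<^sup>2) \<le> 1 / x" by simp
  moreover have "Re ((1 + complex_of_real x * z) / (complex_of_real x - z))
    = ((1 + x * u) * (x - u) - x * y * y) / ((x - u)\<^sup>2 + y\<^sup>2)"
    by (simp add: Re_divide u_def y_def)
  ultimately show ?thesis by simp
qed

lemma Im_inverse_eq: "Im (1 / w) = - Im w / (cmod w)\<^sup>2"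
  by (simp add: Im_divide cmod_power2)

lemma Re_inverse_eq: "Re (1 / w) = Re w / (cmod w)\<^sup>2"
  by (simp add: Re_divide cmod_power2)

text \<open>For \<open>x >= 0\<close> and \<open>u <= b < 0\<close> the cross term in
  \<open>(x - b)^2\<close> is nonnegative, whence \<open>(x - u)^2 >= x^2 + b^2\<close>. Both bounds
  are uniform in the height \<open>y\<close>.\<close>

lemma poisson_kernel_le:
  fixes b u x y :: real
  assumes "0 \<le> x" "u \<le> b" "b < 0" "0 < y"
  shows "1 / ((x - u)\<^sup>2 + y\<^sup>2) \<le> 1 / b\<^sup>2"
    and "(1 + x\<^sup>2) / ((x - u)\<^sup>2 + y\<^sup>2) \<le> 1 + 1 / b\<^sup>2"
proof -
  have "(x - b)\<^sup>2 \<le> (x - u)\<^sup>2" using assms by (intro power_mono) auto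
  moreover have "(x - b)\<^sup>2 = x\<^sup>2 + b\<^sup>2 - 2 * (x * b)" by (simp add: power2_diff)
  moreover have "x * b \<le> 0" using assms by (simp add: mult_nonneg_nonpos)
  ultimately have ge: "x\<^sup>2 + b\<^sup>2 \<le> (x - u)\<^sup>2 + y\<^sup>2" using zero_le_power2[of y] by linarith
  have b2: "b\<^sup>2 > 0" using assms by simp
  have "b\<^sup>2 \<le> (x - u)\<^sup>2 + y\<^sup>2" using ge zero_le_power2[of x] by linarith
  then show "1 / ((x - u)\<^sup>2 + y\<^sup>2) \<le> 1 / b\<^sup>2"
    using b2 by (intro divide_left_mono mult_pos_pos) linarith+
  have pos: "x\<^sup>2 + b\<^sup>2 > 0" using b2 by (simp add: add_nonneg_pos)
  have "(1 + x\<^sup>2) / ((x - u)\<^sup>2 + y\<^sup>2) \<le> (1 + x\<^sup>2) / (x\<^sup>2 + b\<^sup>2)"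
    using ge pos zero_le_power2[of x] by (intro divide_left_mono mult_pos_pos) linarith+
  also have "\<dots> \<le> 1 + 1 / b\<^sup>2"
  proof -
    have "(1 + 1 / b\<^sup>2) * (x\<^sup>2 + b\<^sup>2) = 1 + x\<^sup>2 + b\<^sup>2 + x\<^sup>2 / b\<^sup>2"
      using b2 by (simp add: field_simps)
    moreover have "x\<^sup>2 / b\<^sup>2 \<ge> 0" by simp
    ultimately have "1 + x\<^sup>2 \<le> (1 + 1 / b\<^sup>2) * (x\<^sup>2 + b\<^sup>2)" using b2 by linarith
    then show ?thesis using b2 by (simp add: pos_divide_le_eq add_nonneg_pos)
  qed
  finally show "(1 + x\<^sup>2) / ((x - u)\<^sup>2 + y\<^sup>2) \<le> 1 + 1 / b\<^sup>2" .
qed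

context finite_borel_measure
begin

lemma integrable_nevanlinna_kernel:
  assumes "Im z > 0"
  shows "integrable M (\<lambda>x. (1 + z\<^sup>2) / (complex_of_real x - z))"
    and "integrable M (\<lambda>x. (1 + complex_of_real x * z) / (complex_of_real x - z))"
proof -
  have "integrable M (\<lambda>x. - (1 + z\<^sup>2) * (1 / (z - complex_of_real x)))"
    using integrable_cauchy_kernel[OF assms] by (rule integrable_mult_right)
  moreover have "- (1 + z\<^sup>2) * (1 / (z - complex_of_real x)) = (1 + z\<^sup>2) / (complex_of_real x - z)" for x
    by (metis minus_diff_eq minus_divide_divide minus_divide_right mult.right_neutral times_divide_eq_right)
  ultimately show 1: "integrable M (\<lambda>x. (1 + z\<^sup>2) / (complex_of_real x - z))" by simp
  show "integrable M (\<lambda>x. (1 + complex_of_real x * z) / (complex_of_real x - z))"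
    unfolding nevanlinna_kernel_eq[OF assms] by (intro Bochner_Integration.integrable_add 1) simp
qed

lemma Im_nevanlinna:
  assumes "Im z > 0"
  shows "integrable M (\<lambda>x. (1 + x\<^sup>2) / ((x - Re z)\<^sup>2 + (Im z)\<^sup>2))"
    and "Im (nevanlinna M z) = Im z * (\<integral>x. (1 + x\<^sup>2) / ((x - Re z)\<^sup>2 + (Im z)\<^sup>2) \<partial>M)"
proof -
  have "integrable M (\<lambda>x. Im ((1 + complex_of_real x * z) / (complex_of_real x - z)))"
    using integrable_nevanlinna_kernel(2)[OF assms] by (rule integrable_Im)
  then show "integrable M (\<lambda>x. (1 + x\<^sup>2) / ((x - Re z)\<^sup>2 + (Im z)\<^sup>2))"
    unfolding Im_nevanlinna_kernel[OF assms] using assms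
    by (auto dest!: integrable_mult_right[where c = "1 / Im z"] simp del: times_divide_eq_right simp: mult.assoc[symmetric])
  have "Im (nevanlinna M z) = (\<integral>x. Im ((1 + complex_of_real x * z) / (complex_of_real x - z)) \<partial>M)"
    unfolding nevanlinna_def using integrable_nevanlinna_kernel(2)[OF assms] by (rule integral_Im[symmetric])
  then show "Im (nevanlinna M z) = Im z * (\<integral>x. (1 + x\<^sup>2) / ((x - Re z)\<^sup>2 + (Im z)\<^sup>2) \<partial>M)"
    unfolding Im_nevanlinna_kernel[OF assms] by (simp only: integral_mult_right_zero)
qed

end

text \<open>For \<open>x >= 0\<close> the numerator \<open>x - Re z\<close> is at least
  \<open>-b\<close>, and the denominator is largest at \<open>Re z = a\<close>,
  \<open>Im z = 1\<close>. The resulting minorant does not depend on \<open>z\<close> and has a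
  positive integral, which serves as \<open>c\<close>.\<close>

lemma (in real_distribution) Re_cauchy_G_bounded_below:
  assumes null: "emeasure M {..<0} = 0" and "a < b" "b < 0"
  obtains c where "c > 0" "\<And>z. a \<le> Re z \<Longrightarrow> Re z \<le> b \<Longrightarrow> 0 < Im z \<Longrightarrow> Im z \<le> 1 \<Longrightarrow> c \<le> - Re (cauchy_G M z)"
proof
  note int = integrable_poisson_kernel[of 1 a]
  have "(\<integral>x. 0 \<partial>M) < (\<integral>x. - b * (1 / ((x - a)\<^sup>2 + 1\<^sup>2)) \<partial>M)"
  proof (rule integral_less_AE_space)
    show "integrable M (\<lambda>x. - b * (1 / ((x - a)\<^sup>2 + 1\<^sup>2)))"
      using int by (intro integrable_mult_right) simp
    show "AE x in M. 0 < - b * (1 / ((x - a)\<^sup>2 + 1\<^sup>2))"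
      using \<open>b < 0\<close> by (intro AE_I2 mult_pos_pos divide_pos_pos) (auto intro: add_nonneg_pos)
  qed (use emeasure_space_1 in auto)
  then show "0 < (\<integral>x. - b * (1 / ((x - a)\<^sup>2 + 1\<^sup>2)) \<partial>M)" by simp
  fix z assume z: "a \<le> Re z" "Re z \<le> b" "0 < Im z" "Im z \<le> 1"
  show "(\<integral>x. - b * (1 / ((x - a)\<^sup>2 + 1\<^sup>2)) \<partial>M) \<le> - Re (cauchy_G M z)"
    unfolding Re_cauchy_G(2)[OF z(3)]
  proof (rule integral_mono_AE)
    show "integrable M (\<lambda>x. - b * (1 / ((x - a)\<^sup>2 + 1\<^sup>2)))"
      using int by (intro integrable_mult_right) simp
    have "- b * (1 / ((x - a)\<^sup>2 + 1\<^sup>2)) \<le> (x - Re z) / ((x - Re z)\<^sup>2 + (Im z)\<^sup>2)" if "0 \<le> x" for x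
    proof -
      have "(x - Re z)\<^sup>2 \<le> (x - a)\<^sup>2" "(Im z)\<^sup>2 \<le> 1\<^sup>2" using z that \<open>b < 0\<close> by (intro power_mono; simp)+
      then have "(- b) / ((x - a)\<^sup>2 + 1\<^sup>2) \<le> (x - Re z) / ((x - Re z)\<^sup>2 + (Im z)\<^sup>2)"
        using z that \<open>b < 0\<close> by (intro frac_le add_mono add_nonneg_pos) auto
      then show ?thesis by simp
    qed
    then show "AE x in M. - b * (1 / ((x - a)\<^sup>2 + 1\<^sup>2)) \<le> (x - Re z) / ((x - Re z)\<^sup>2 + (Im z)\<^sup>2)"
      using AE_nonneg_if_null[OF M_is_borel null] by auto
  qed (rule Re_cauchy_G(1)[OF z(3)])
qed

text \<open>A single time is fixed: \<open>\<mu>\<close> is the law at time \<open>t\<close>,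
  whereas \<open>\<gamma>\<close> and \<open>\<tau>\<close> are the data of time 1. Admitting
  \<open>t = 0\<close> lets the converse direction reach every time in condition (2).\<close>

locale boolean_levy_khintchine =
  mu: real_distribution \<mu> + tau: finite_borel_measure \<tau> for \<mu> \<tau> :: "real measure" +
  fixes t \<gamma> :: real
  assumes t_nonneg: "t \<ge> 0"
    and H_eq: "\<And>z. Im z > 0 \<Longrightarrow> cauchy_H \<mu> z = z - complex_of_real t * (complex_of_real \<gamma> - nevanlinna \<tau> z)"
begin

text \<open>The imaginary part of \<open>H\<close> is computed twice: from \<open>\<tau>\<close> by
  the representation, and from \<open>\<mu>\<close> as \<open>Im z\<close> times its Poisson
  integral divided by the squared modulus of \<open>G\<close>. The second expression is bounded by a
  multiple of \<open>Im z\<close>, so the Poisson integral of \<open>\<tau>\<close> is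
  bounded.\<close>

lemma levy_measure_null_negatives:
  assumes "t > 0" and null: "emeasure \<mu> {..<0} = 0"
  shows "emeasure \<tau> {..<0} = 0"
proof (rule tau.null_negatives)
  fix a b :: real assume ab: "a < b" "b < 0"
  obtain c where c: "c > 0" "\<And>z. a \<le> Re z \<Longrightarrow> Re z \<le> b \<Longrightarrow> 0 < Im z \<Longrightarrow> Im z \<le> 1 \<Longrightarrow> c \<le> - Re (cauchy_G \<mu> z)"
    using mu.Re_cauchy_G_bounded_below[OF null ab] by blast
  have "(\<integral>x. 1 / ((x - u)\<^sup>2 + y\<^sup>2) \<partial>\<tau>) \<le> 1 / (t * b\<^sup>2 * c\<^sup>2)"
    if uy: "u \<in> {a..b}" "y \<in> {0<..1}" for u y
  proof -
    define z where "z = Complex u y"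
    have z: "Re z = u" "Im z = y" "Im z > 0" using uy by (auto simp: z_def)
    have "c \<le> \<bar>Re (cauchy_G \<mu> z)\<bar>" using c(2)[of z] uy z by auto
    then have cmod: "c\<^sup>2 \<le> (cmod (cauchy_G \<mu> z))\<^sup>2"
      using c(1) abs_Re_le_cmod[of "cauchy_G \<mu> z"] by (intro power_mono) auto
    have "(\<integral>x. 1 / ((x - u)\<^sup>2 + y\<^sup>2) \<partial>\<mu>) \<le> (\<integral>x. 1 / b\<^sup>2 \<partial>\<mu>)"
    proof (rule integral_mono_AE)
      show "AE x in \<mu>. 1 / ((x - u)\<^sup>2 + y\<^sup>2) \<le> 1 / b\<^sup>2"
        using AE_nonneg_if_null[OF mu.M_is_borel null]
      proof eventually_elim
        case (elim x)
        then show ?case using uy ab by (intro poisson_kernel_le) auto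
      qed
    qed (use mu.integrable_poisson_kernel uy in auto)
    then have P: "(\<integral>x. 1 / ((x - u)\<^sup>2 + y\<^sup>2) \<partial>\<mu>) \<le> 1 / b\<^sup>2" using mu.prob_space by simp
    \<comment> \<open>The summand \<open>y\<close> is dropped and the weight \<open>1 + x^2\<close>
      weakened to 1; the factor \<open>y\<close> is kept to be cancelled at the end.\<close>
    have "y * (t * (\<integral>x. 1 / ((x - u)\<^sup>2 + y\<^sup>2) \<partial>\<tau>)) \<le> y + t * (y * (\<integral>x. (1 + x\<^sup>2) / ((x - u)\<^sup>2 + y\<^sup>2) \<partial>\<tau>))"
    proof -
      have "(\<integral>x. 1 / ((x - u)\<^sup>2 + y\<^sup>2) \<partial>\<tau>) \<le> (\<integral>x. (1 + x\<^sup>2) / ((x - u)\<^sup>2 + y\<^sup>2) \<partial>\<tau>)"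
        using tau.Im_nevanlinna(1)[OF z(3)] uy z tau.integrable_poisson_kernel[of y u]
        by (intro integral_mono) (auto intro!: divide_right_mono)
      then have "y * (t * (\<integral>x. 1 / ((x - u)\<^sup>2 + y\<^sup>2) \<partial>\<tau>)) \<le> y * (t * (\<integral>x. (1 + x\<^sup>2) / ((x - u)\<^sup>2 + y\<^sup>2) \<partial>\<tau>))"
        using \<open>t > 0\<close> uy by (intro mult_left_mono) auto
      then show ?thesis using uy by (simp add: mult.left_commute)
    qed
    also have "\<dots> = Im (cauchy_H \<mu> z)"
      using H_eq[OF z(3)] tau.Im_nevanlinna(2)[OF z(3)] z by simp
    also have "\<dots> = y * (\<integral>x. 1 / ((x - u)\<^sup>2 + y\<^sup>2) \<partial>\<mu>) / (cmod (cauchy_G \<mu> z))\<^sup>2"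
      using mu.Im_cauchy_G[OF z(3)] z unfolding cauchy_H_def Im_inverse_eq by simp
    also have "\<dots> \<le> y * (1 / b\<^sup>2) / c\<^sup>2"
      using cmod c(1) P uy ab by (intro frac_le mult_left_mono) auto
    finally have "y * (t * (\<integral>x. 1 / ((x - u)\<^sup>2 + y\<^sup>2) \<partial>\<tau>)) \<le> y * (1 / b\<^sup>2 / c\<^sup>2)" by simp
    then have "t * (\<integral>x. 1 / ((x - u)\<^sup>2 + y\<^sup>2) \<partial>\<tau>) \<le> 1 / b\<^sup>2 / c\<^sup>2"
      using uy by (simp only: greaterThanAtMost_iff mult_le_cancel_left_pos)
    then show ?thesis
      using \<open>t > 0\<close> divide_right_mono[of _ "1 / b\<^sup>2 / c\<^sup>2" t] by (fastforce simp: mult.commute mult.left_commute)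
  qed
  then show "\<exists>C. \<forall>u\<in>{a..b}. \<forall>y\<in>{0<..1}. (\<integral>x. 1 / ((x - u)\<^sup>2 + y\<^sup>2) \<partial>\<tau>) \<le> C" by blast
qed

end

section \<open>Behaviour of the Nevanlinna integral as \<open>z\<close> tends to 0\<close>

lemma Re_resolvent_kernel:
  "Re ((1 + z\<^sup>2) / (complex_of_real x - z))
    = ((1 + (Re z)\<^sup>2 - (Im z)\<^sup>2) * (x - Re z) - 2 * Re z * (Im z)\<^sup>2) / ((x - Re z)\<^sup>2 + (Im z)\<^sup>2)"
  by (simp add: Re_divide power2_eq_square algebra_simps)

text \<open>The height bound \<open>Im z <= 1\<close> keeps the coefficient
  \<open>1 + (Re z)^2 - (Im z)^2\<close> nonnegative, and \<open>Re z <= 0\<close> gives the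
  remaining term the right sign. This nonnegativity is what Fatou's lemma requires.\<close>

lemma Re_resolvent_kernel_nonneg:
  assumes "Im z \<in> {0<..1}" "Re z \<le> 0" "x \<ge> 0"
  shows "0 \<le> Re ((1 + z\<^sup>2) / (complex_of_real x - z))"
proof -
  have "(Im z)\<^sup>2 \<le> 1" using assms by (simp add: power_le_one)
  then have "0 \<le> (1 + (Re z)\<^sup>2 - (Im z)\<^sup>2) * (x - Re z)"
    using assms zero_le_power2[of "Re z"] by (intro mult_nonneg_nonneg) linarith+
  moreover have "2 * Re z * (Im z)\<^sup>2 \<le> 0"
    by (rule mult_nonpos_nonneg) (use assms in auto)
  ultimately have "0 \<le> (1 + (Re z)\<^sup>2 - (Im z)\<^sup>2) * (x - Re z) - 2 * Re z * (Im z)\<^sup>2" by linarith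
  then show ?thesis
    unfolding Re_resolvent_kernel by (intro divide_nonneg_nonneg) auto
qed

lemma (in real_distribution) Re_cauchy_H_nonpos:
  assumes null: "emeasure M {..<0} = 0" and "Im z > 0" "Re z \<le> 0"
  shows "Re (cauchy_H M z) \<le> 0"
proof -
  have "0 \<le> - Re (cauchy_G M z)"
    unfolding Re_cauchy_G(2)[OF assms(2)]
    by (rule integral_nonneg_AE)
       (use AE_nonneg_if_null[OF M_is_borel null] assms(3) in \<open>auto simp: divide_nonneg_nonneg\<close>)
  then show ?thesis
    unfolding cauchy_H_def Re_inverse_eq by (intro divide_nonpos_nonneg) auto
qed

context boolean_levy_khintchine
begin

text \<open>Since \<open>Re H <= 0\<close>, the representation gives
  \<open>t * Re K >= Re z\<close>. Splitting the kernel moves the total mass of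
  \<open>\<tau>\<close> into an error proportional to \<open>Re z\<close>, which disappears in the
  limit at 0.\<close>

lemma integral_Re_resolvent_kernel_le:
  assumes "t > 0" and null: "emeasure \<mu> {..<0} = 0" and z: "Im z > 0" "Re z \<le> 0"
  shows "(\<integral>x. Re ((1 + z\<^sup>2) / (complex_of_real x - z)) \<partial>\<tau>) \<le> \<gamma> - Re z * (1 / t + measure \<tau> UNIV)"
proof -
  have space: "space \<tau> = UNIV" using sets_eq_imp_space_eq[OF tau.M_is_borel] by simp
  note int = tau.integrable_nevanlinna_kernel[OF z(1)]
  have "nevanlinna \<tau> z = (\<integral>x. z + (1 + z\<^sup>2) / (complex_of_real x - z) \<partial>\<tau>)"
    unfolding nevanlinna_def nevanlinna_kernel_eq[OF z(1)] ..
  also have "\<dots> = measure \<tau> UNIV *\<^sub>R z + (\<integral>x. (1 + z\<^sup>2) / (complex_of_real x - z) \<partial>\<tau>)"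
    using int(1) by (subst Bochner_Integration.integral_add) (auto simp: space)
  finally have N: "Re (nevanlinna \<tau> z) = measure \<tau> UNIV * Re z + (\<integral>x. Re ((1 + z\<^sup>2) / (complex_of_real x - z)) \<partial>\<tau>)"
    using int(1) by simp
  have "Re z - t * (\<gamma> - Re (nevanlinna \<tau> z)) \<le> 0"
    using mu.Re_cauchy_H_nonpos[OF null z] H_eq[OF z(1)] by simp
  then have "Re z / t \<le> \<gamma> - Re (nevanlinna \<tau> z)"
    using \<open>t > 0\<close> by (simp add: divide_le_eq mult.commute)
  then show ?thesis
    using \<open>t > 0\<close> unfolding N by (simp add: algebra_simps)
qed

text \<open>Along a sequence tending to 0 the nonnegative kernels converge to \<open>1 / x\<close>
  on the positive half-line while their integrals stay below a quantity tending to
  \<open>\<gamma>\<close>, so Fatou applies. At \<open>x = 0\<close> the kernels blow up, which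
  rules out an atom there.\<close>

lemma levy_measure_integral_inverse:
  assumes "t > 0" and null: "emeasure \<mu> {..<0} = 0"
  shows "\<gamma> \<ge> 0" "(\<integral>\<^sup>+ x\<in>{0<..}. ennreal (1 / x) \<partial>\<tau>) \<le> ennreal \<gamma>" "emeasure \<tau> {0} = 0"
proof -
  define B where "B = 1 / t + measure \<tau> UNIV"
  define e where "e n = inverse (real (Suc n))" for n
  \<comment> \<open>The diagonal approach matters for the atom: on the imaginary axis the kernel
    would vanish at \<open>x = 0\<close>, whereas here it is
    \<open>1 / (2 * e n) + e n\<close>.\<close>
  define z where "z n = Complex (- e n) (e n)" for n
  define k where "k n x = Re ((1 + (z n)\<^sup>2) / (complex_of_real x - z n))" for n x
  have e: "0 < e n" "e n \<le> 1" for n by (auto simp: e_def field_simps)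
  have e_lim: "e \<longlonglongrightarrow> 0" unfolding e_def by (rule LIMSEQ_inverse_real_of_nat)
  have k_eq: "k n x = (x + e n + 2 * (e n)^3) / ((x + e n)\<^sup>2 + (e n)\<^sup>2)" for n x
    unfolding k_def Re_resolvent_kernel by (simp add: z_def power2_eq_square power3_eq_cube)
  have AE_nonneg: "AE x in \<tau>. 0 \<le> x"
    using AE_nonneg_if_null[OF tau.M_is_borel levy_measure_null_negatives[OF assms]] .
  have k_nonneg: "0 \<le> k n x" if "0 \<le> x" for n x
    unfolding k_def using e[of n] that by (intro Re_resolvent_kernel_nonneg) (auto simp: z_def)
  have AE_k: "AE x in \<tau>. 0 \<le> k n x" for n
    using AE_nonneg by eventually_elim (rule k_nonneg)
  have k_int: "integrable \<tau> (k n)" for n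
    unfolding k_def by (intro integrable_Re tau.integrable_nevanlinna_kernel) (simp add: z_def e)
  have le: "(\<integral>x. k n x \<partial>\<tau>) \<le> \<gamma> + e n * B" for n
    using integral_Re_resolvent_kernel_le[OF assms, of "z n"] e[of n]
    by (simp add: k_def z_def B_def)
  have nonneg: "0 \<le> \<gamma> + e n * B" for n
    using le[of n] integral_nonneg_AE[OF AE_k[of n]] by linarith
  have lim: "(\<lambda>n. \<gamma> + e n * B) \<longlonglongrightarrow> \<gamma>"
    using tendsto_add[OF tendsto_const[of \<gamma>] tendsto_mult_left_zero[OF e_lim, of B]] by simp
  show "\<gamma> \<ge> 0"
    using lim nonneg by (intro LIMSEQ_le_const) auto
  have nn: "(\<integral>\<^sup>+ x. ennreal (k n x) \<partial>\<tau>) \<le> ennreal (\<gamma> + e n * B)" for n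
    unfolding nn_integral_eq_integral[OF k_int AE_k] using le by (rule ennreal_leI)
  have k_lim: "(\<lambda>n. k n x) \<longlonglongrightarrow> 1 / x" if "x > 0" for x
  proof -
    have "(\<lambda>n. (x + e n + 2 * (e n)^3) / ((x + e n)\<^sup>2 + (e n)\<^sup>2)) \<longlonglongrightarrow> (x + 0 + 2 * 0^3) / ((x + 0)\<^sup>2 + 0\<^sup>2)"
      using that by (intro tendsto_intros e_lim) auto
    then show ?thesis using that unfolding k_eq by (simp add: power2_eq_square)
  qed
  have "(\<integral>\<^sup>+ x\<in>{0<..}. ennreal (1 / x) \<partial>\<tau>) \<le> (\<integral>\<^sup>+ x. liminf (\<lambda>n. ennreal (k n x)) \<partial>\<tau>)"
  proof (rule nn_integral_mono)
    fix x
    show "ennreal (1 / x) * indicator {0<..} x \<le> liminf (\<lambda>n. ennreal (k n x))"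
    proof (cases "x > 0")
      case True
      then have "liminf (\<lambda>n. ennreal (k n x)) = ennreal (1 / x)"
        by (intro lim_imp_Liminf tendsto_ennrealI k_lim) auto
      then show ?thesis using True by simp
    qed auto
  qed
  also have "\<dots> \<le> liminf (\<lambda>n. \<integral>\<^sup>+ x. ennreal (k n x) \<partial>\<tau>)"
    using k_int by (intro nn_integral_liminf) auto
  also have "\<dots> \<le> liminf (\<lambda>n. ennreal (\<gamma> + e n * B))"
    using nn by (intro Liminf_mono) auto
  also have "\<dots> = ennreal \<gamma>"
    using lim by (intro lim_imp_Liminf tendsto_ennrealI) auto
  finally show "(\<integral>\<^sup>+ x\<in>{0<..}. ennreal (1 / x) \<partial>\<tau>) \<le> ennreal \<gamma>" .
  \<comment> \<open>Only the contribution of the point 0 is kept, where the kernel is at least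
    \<open>1 / (2 * e n)\<close>.\<close>
  have atom: "measure \<tau> {0} \<le> 2 * e n * (\<gamma> + e n * B)" for n
  proof -
    have "1 / (2 * e n) * measure \<tau> {0} = (\<integral>x. 1 / (2 * e n) * indicator {0} x \<partial>\<tau>)"
      by (subst integral_mult_right_zero) simp
    also have "\<dots> \<le> (\<integral>x. k n x \<partial>\<tau>)"
    proof (rule integral_mono_AE)
      show "integrable \<tau> (\<lambda>x. 1 / (2 * e n) * indicat_real {0} x)"
        by (intro integrable_mult_right integrable_real_indicator) (auto simp: tau.M_is_borel less_top[symmetric])
      have "1 / (2 * e n) \<le> k n 0"
      proof -
        have "k n 0 = 1 / (2 * e n) + e n"
          unfolding k_eq using e(1)[of n] by (simp add: field_simps power2_eq_square power3_eq_cube)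
        then show ?thesis using e(1)[of n] by linarith
      qed
      then have "1 / (2 * e n) * indicat_real {0} x \<le> k n x" if "0 \<le> x" for x
        using k_nonneg[OF that] by (auto simp: indicator_def)
      then show "AE x in \<tau>. 1 / (2 * e n) * indicat_real {0} x \<le> k n x"
        using AE_nonneg by auto
    qed (rule k_int)
    also have "\<dots> \<le> \<gamma> + e n * B" by (rule le)
    finally show ?thesis using e(1)[of n] by (simp add: field_simps)
  qed
  have "(\<lambda>n. 2 * e n * (\<gamma> + e n * B)) \<longlonglongrightarrow> 2 * 0 * \<gamma>"
    by (intro tendsto_mult tendsto_const e_lim lim)
  then have "measure \<tau> {0} \<le> 2 * 0 * \<gamma>"
    by (rule LIMSEQ_le_const) (use atom in auto)
  then show "emeasure \<tau> {0} = 0"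
    by (simp add: tau.emeasure_eq_measure measure_le_0_iff)
qed

text \<open>The roles of the two measures are exchanged. Now \<open>Re K >= 0\<close> forces
  \<open>Re H <= b < 0\<close>, so \<open>H\<close> has modulus at least \<open>-b\<close>, and the
  Poisson integral of \<open>\<mu>\<close> equals \<open>Im H\<close> divided by \<open>Im z\<close>
  and by the squared modulus of \<open>H\<close>.\<close>

lemma null_negatives_if_levy_measure:
  assumes pos: "AE x in \<tau>. 0 < x" and int: "integrable \<tau> (\<lambda>x. 1 / x)" and le: "(\<integral>x. 1 / x \<partial>\<tau>) \<le> \<gamma>"
  shows "emeasure \<mu> {..<0} = 0"
proof (rule mu.null_negatives)
  fix a b :: real assume ab: "a < b" "b < 0"
  \<comment> \<open>\<open>D\<close> bounds \<open>Im H / Im z\<close>: the 1 comes from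
    \<open>z\<close> itself, the rest from integrating the uniform bound on the weighted Poisson
    kernel over the total mass of \<open>\<tau>\<close>.\<close>
  define D where "D = 1 + t * (measure \<tau> (space \<tau>) * (1 + 1 / b\<^sup>2))"
  have "(\<integral>x. 1 / ((x - u)\<^sup>2 + y\<^sup>2) \<partial>\<mu>) \<le> D / b\<^sup>2" if uy: "u \<in> {a..b}" "y \<in> {0<..1}" for u y
  proof -
    define z where "z = Complex u y"
    have z: "Re z = u" "Im z = y" "Im z > 0" using uy by (auto simp: z_def)
    have "Re (nevanlinna \<tau> z) = (\<integral>x. Re ((1 + complex_of_real x * z) / (complex_of_real x - z)) \<partial>\<tau>)"
      unfolding nevanlinna_def using tau.integrable_nevanlinna_kernel(2)[OF z(3)] by (rule integral_Re[symmetric])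
    also have "\<dots> \<le> (\<integral>x. 1 / x \<partial>\<tau>)"
    proof (rule integral_mono_AE)
      show "AE x in \<tau>. Re ((1 + complex_of_real x * z) / (complex_of_real x - z)) \<le> 1 / x"
        using pos
      proof eventually_elim
        case (elim x)
        then show ?case using z uy ab by (intro Re_nevanlinna_kernel_le) auto
      qed
    qed (use int tau.integrable_nevanlinna_kernel(2)[OF z(3)] in \<open>auto intro: integrable_Re\<close>)
    finally have "0 \<le> \<gamma> - Re (nevanlinna \<tau> z)" using le by linarith
    then have "0 \<le> t * (\<gamma> - Re (nevanlinna \<tau> z))"
      using t_nonneg by (intro mult_nonneg_nonneg)
    moreover have "Re (cauchy_H \<mu> z) = u - t * (\<gamma> - Re (nevanlinna \<tau> z))"
      using H_eq[OF z(3)] z by simp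
    ultimately have "Re (cauchy_H \<mu> z) \<le> b" using uy by auto
    then have "- b \<le> cmod (cauchy_H \<mu> z)"
      using abs_Re_le_cmod[of "cauchy_H \<mu> z"] by linarith
    then have cmod: "b\<^sup>2 \<le> (cmod (cauchy_H \<mu> z))\<^sup>2"
      using ab power_mono[of "- b" "cmod (cauchy_H \<mu> z)" 2] by simp
    have "(\<integral>x. (1 + x\<^sup>2) / ((x - u)\<^sup>2 + y\<^sup>2) \<partial>\<tau>) \<le> (\<integral>x. 1 + 1 / b\<^sup>2 \<partial>\<tau>)"
    proof (rule integral_mono_AE)
      show "AE x in \<tau>. (1 + x\<^sup>2) / ((x - u)\<^sup>2 + y\<^sup>2) \<le> 1 + 1 / b\<^sup>2"
        using pos
      proof eventually_elim
        case (elim x)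
        then show ?case using uy ab by (intro poisson_kernel_le) auto
      qed
    qed (use tau.Im_nevanlinna(1)[OF z(3)] z in auto)
    also have "\<dots> = measure \<tau> (space \<tau>) * (1 + 1 / b\<^sup>2)" by simp
    finally have Q: "(\<integral>x. (1 + x\<^sup>2) / ((x - u)\<^sup>2 + y\<^sup>2) \<partial>\<tau>) \<le> measure \<tau> (space \<tau>) * (1 + 1 / b\<^sup>2)" .
    have "y * (\<integral>x. 1 / ((x - u)\<^sup>2 + y\<^sup>2) \<partial>\<mu>) = - Im (1 / cauchy_H \<mu> z)"
      using mu.Im_cauchy_G[OF z(3)] z by (simp add: cauchy_H_def)
    also have "\<dots> = Im (cauchy_H \<mu> z) / (cmod (cauchy_H \<mu> z))\<^sup>2"
      unfolding Im_inverse_eq by simp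
    also have "Im (cauchy_H \<mu> z) = y * (1 + t * (\<integral>x. (1 + x\<^sup>2) / ((x - u)\<^sup>2 + y\<^sup>2) \<partial>\<tau>))"
      using H_eq[OF z(3)] tau.Im_nevanlinna(2)[OF z(3)] z by (simp add: distrib_left mult.left_commute)
    also have "\<dots> / (cmod (cauchy_H \<mu> z))\<^sup>2 \<le> (y * D) / b\<^sup>2"
    proof (rule frac_le)
      show "y * (1 + t * (\<integral>x. (1 + x\<^sup>2) / ((x - u)\<^sup>2 + y\<^sup>2) \<partial>\<tau>)) \<le> y * D"
        unfolding D_def using uy t_nonneg Q by (intro mult_left_mono add_left_mono) auto
      show "0 \<le> y * D"
        unfolding D_def using uy t_nonneg by (intro mult_nonneg_nonneg add_nonneg_nonneg) auto
    qed (use cmod ab in auto)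
    finally have "y * (\<integral>x. 1 / ((x - u)\<^sup>2 + y\<^sup>2) \<partial>\<mu>) \<le> y * (D / b\<^sup>2)" by simp
    then show ?thesis using uy by (simp only: greaterThanAtMost_iff mult_le_cancel_left_pos)
  qed
  then show "\<exists>C. \<forall>u\<in>{a..b}. \<forall>y\<in>{0<..1}. (\<integral>x. 1 / ((x - u)\<^sup>2 + y\<^sup>2) \<partial>\<mu>) \<le> C" by blast
qed

end

section \<open>Linearity of \<open>K\<close> in time\<close>

lemma (in real_distribution) cauchy_G_neq_0:
  assumes "Im z > 0"
  shows "cauchy_G M z \<noteq> 0"
proof -
  have "(\<integral>x. 0 \<partial>M) < (\<integral>x. 1 / ((x - Re z)\<^sup>2 + (Im z)\<^sup>2) \<partial>M)"
  proof (rule integral_less_AE_space)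
    show "integrable M (\<lambda>x. 1 / ((x - Re z)\<^sup>2 + (Im z)\<^sup>2))"
      using assms by (rule integrable_poisson_kernel)
    show "AE x in M. 0 < 1 / ((x - Re z)\<^sup>2 + (Im z)\<^sup>2)"
      using assms by (intro AE_I2 divide_pos_pos add_nonneg_pos) auto
  qed (use emeasure_space_1 in auto)
  then have "Im (cauchy_G M z) < 0"
    unfolding Im_cauchy_G[OF assms] using assms by (simp add: mult_neg_pos)
  then show ?thesis by auto
qed

lemma cauchy_G_weak_conv:
  assumes "\<And>n. real_distribution (M n)" "real_distribution N" "weak_conv_m M N" "Im z > 0"
  shows "(\<lambda>n. cauchy_G (M n) z) \<longlonglongrightarrow> cauchy_G N z"
  unfolding cauchy_G_def
proof (rule weak_conv_imp_integral_bdd_continuous_conv[OF assms(1-3)])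
  have ne: "z - complex_of_real x \<noteq> 0" for x
    using assms(4) by (auto simp: complex_eq_iff)
  show "isCont (\<lambda>x. 1 / (z - complex_of_real x)) x" for x
    using ne by (intro continuous_intros) auto
  show "norm (1 / (z - complex_of_real x)) \<le> 1 / Im z" for x
    using abs_Im_le_cmod[of "z - complex_of_real x"] assms(4) ne[of x]
    by (simp add: norm_divide divide_simps)
qed

text \<open>This is Cauchy's functional equation: additivity gives the claim at rational times, and
  weak continuity extends it. The limit passes from \<open>G\<close> to \<open>H\<close> because the
  limiting \<open>G\<close> does not vanish in the upper half-plane.\<close>

lemma boolean_semigroup_cauchy_K:
  assumes \<mu>: "boolean_semigroup \<mu>" and z: "Im z > 0" and "t \<ge> 0"
  shows "cauchy_K (\<mu> t) z = complex_of_real t * cauchy_K (\<mu> 1) z"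
proof -
  have distr: "real_distribution (\<mu> s)" if "s \<ge> 0" for s
    using \<mu> that by (simp add: boolean_semigroup_def prob_real_def)
  have add: "cauchy_K (\<mu> (r + s)) z = cauchy_K (\<mu> r) z + cauchy_K (\<mu> s) z" if "r \<ge> 0" "s \<ge> 0" for r s
    using \<mu> that z by (simp add: boolean_semigroup_def is_boolean_conv_def)
  have mult: "cauchy_K (\<mu> (real n * s)) z = of_nat n * cauchy_K (\<mu> s) z" if "s \<ge> 0" for n s
  proof (induction n)
    \<comment> \<open>Additivity at the times 0 and 0 forces \<open>K\<close> to vanish at time
      0.\<close>
    case 0
    then show ?case using add[of 0 0] by simp
  next
    case (Suc n)
    then show ?case
      using add[of s "real n * s"] that by (simp add: algebra_simps)
  qed
  \<comment> \<open>The rational times \<open>s n\<close> have denominator \<open>n + 1\<close> and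
    approach \<open>t\<close> from below to within \<open>1 / (n + 1)\<close>.\<close>
  define N where "N n = nat \<lfloor>real (Suc n) * t\<rfloor>" for n
  define s where "s n = real (N n) * (1 / real (Suc n))" for n
  have s_lim: "s \<longlonglongrightarrow> t"
  proof (rule real_tendsto_sandwich)
    have N: "real (N n) \<le> real (Suc n) * t" "real (Suc n) * t - 1 \<le> real (N n)" for n
      unfolding N_def using \<open>t \<ge> 0\<close> by (auto simp: of_nat_nat)
    show "eventually (\<lambda>n. t - inverse (real (Suc n)) \<le> s n) sequentially"
    proof (intro always_eventually allI)
      fix n
      have "(real (Suc n) * t - 1) / real (Suc n) \<le> real (N n) / real (Suc n)"
        by (rule divide_right_mono[OF N(2)]) simp
      then show "t - inverse (real (Suc n)) \<le> s n"
        by (simp add: s_def diff_divide_distrib inverse_eq_divide del: of_nat_Suc)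
    qed
    show "eventually (\<lambda>n. s n \<le> t) sequentially"
      using N(1) by (intro always_eventually allI) (simp add: s_def field_simps)
    show "(\<lambda>n. t - inverse (real (Suc n))) \<longlonglongrightarrow> t"
      using tendsto_diff[OF tendsto_const LIMSEQ_inverse_real_of_nat, of t] by simp
  qed simp
  \<comment> \<open>The values at time 1 and at time \<open>s n\<close> are both integer multiples
    of the value at time \<open>1 / (n + 1)\<close>.\<close>
  have s_K: "cauchy_K (\<mu> (s n)) z = complex_of_real (s n) * cauchy_K (\<mu> 1) z" for n
  proof -
    have "cauchy_K (\<mu> 1) z = of_nat (Suc n) * cauchy_K (\<mu> (1 / real (Suc n))) z"
      using mult[of "1 / real (Suc n)" "Suc n"] by (simp del: of_nat_Suc)
    then show ?thesis
      using mult[of "1 / real (Suc n)" "N n"] unfolding s_def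
      by (simp add: field_simps del: of_nat_Suc)
  qed
  have "(\<lambda>n. cauchy_G (\<mu> (s n)) z) \<longlonglongrightarrow> cauchy_G (\<mu> t) z"
  proof (rule cauchy_G_weak_conv)
    have "\<forall>n. 0 \<le> s n" by (simp add: s_def)
    then show "weak_conv_m (\<lambda>n. \<mu> (s n)) (\<mu> t)"
      using \<mu> \<open>t \<ge> 0\<close> s_lim by (simp add: boolean_semigroup_def weakly_continuous_family_def)
  qed (use distr \<open>t \<ge> 0\<close> z in \<open>auto simp: s_def\<close>)
  then have "(\<lambda>n. cauchy_K (\<mu> (s n)) z) \<longlonglongrightarrow> cauchy_K (\<mu> t) z"
    unfolding cauchy_K_def cauchy_H_def
    using real_distribution.cauchy_G_neq_0[OF distr[OF \<open>t \<ge> 0\<close>] z] by (intro tendsto_intros)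
  moreover have "(\<lambda>n. cauchy_K (\<mu> (s n)) z) \<longlonglongrightarrow> complex_of_real t * cauchy_K (\<mu> 1) z"
    unfolding s_K using s_lim by (intro tendsto_intros)
  ultimately show ?thesis by (rule LIMSEQ_unique)
qed

text \<open>Nonnegative support at any one positive time yields the conditions on
  \<open>\<gamma>\<close> and \<open>\<tau>\<close>, and these yield nonnegative support at every
  time; both equivalences follow from this cycle.\<close>

lemma boolean_semigroup_nonneg_support_iff:
  assumes \<mu>: "boolean_semigroup \<mu>" and \<tau>: "finite_measure \<tau>" "sets \<tau> = sets borel"
    and K: "\<And>z. Im z > 0 \<Longrightarrow> cauchy_K (\<mu> 1) z = complex_of_real \<gamma> - nevanlinna \<tau> z"
  shows "(\<exists>t0>0. msupp (\<mu> t0) \<subseteq> {0..}) \<longleftrightarrow> (\<forall>t\<ge>0. msupp (\<mu> t) \<subseteq> {0..})"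
    and "(\<forall>t\<ge>0. msupp (\<mu> t) \<subseteq> {0..}) \<longleftrightarrow>
      msupp \<tau> \<subseteq> {0..} \<and> emeasure \<tau> {0} = 0 \<and>
      (\<integral>\<^sup>+ x\<in>{0<..}. ennreal (1 / x) \<partial>\<tau>) < \<infinity> \<and> \<gamma> \<ge> (\<integral>x\<in>{0<..}. 1 / x \<partial>\<tau>)"
    (is "_ \<longleftrightarrow> ?levy")
proof -
  have distr: "real_distribution (\<mu> t)" if "t \<ge> 0" for t
    using \<mu> that by (simp add: boolean_semigroup_def prob_real_def)
  have tau: "finite_borel_measure \<tau>"
    using \<tau> by (intro finite_borel_measure.intro) (auto simp: finite_borel_measure_axioms_def)
  have lk: "boolean_levy_khintchine (\<mu> t) \<tau> t \<gamma>" if "t \<ge> 0" for t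
  proof (intro boolean_levy_khintchine.intro boolean_levy_khintchine_axioms.intro distr tau that)
    fix z assume z: "Im z > 0"
    show "cauchy_H (\<mu> t) z = z - complex_of_real t * (complex_of_real \<gamma> - nevanlinna \<tau> z)"
      using boolean_semigroup_cauchy_K[OF \<mu> z that] unfolding K[OF z] cauchy_K_def[of "\<mu> t"]
      by (simp add: diff_eq_eq eq_diff_eq add.commute)
  qed
  have supp: "msupp (\<mu> t) \<subseteq> {0..} \<longleftrightarrow> emeasure (\<mu> t) {..<0} = 0" if "t \<ge> 0" for t
    using real_distribution.events_eq_borel[OF distr[OF that]] by (rule msupp_subset_nonneg_iff)
  have levy: ?levy if "t > 0" "msupp (\<mu> t) \<subseteq> {0..}" for t
  proof (intro conjI)
    interpret boolean_levy_khintchine "\<mu> t" \<tau> t \<gamma> using lk that by simp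
    have null: "emeasure (\<mu> t) {..<0} = 0" using supp that by simp
    note levy = levy_measure_integral_inverse[OF that(1) null]
    show "msupp \<tau> \<subseteq> {0..}"
      using levy_measure_null_negatives[OF that(1) null] \<tau>(2) msupp_subset_nonneg_iff by blast
    show "emeasure \<tau> {0} = 0" by (rule levy(3))
    show "(\<integral>\<^sup>+ x\<in>{0<..}. ennreal (1 / x) \<partial>\<tau>) < \<infinity>"
      using levy(2) by (rule le_less_trans) simp
    have "(\<integral>x\<in>{0<..}. 1 / x \<partial>\<tau>) = enn2real (\<integral>\<^sup>+ x. ennreal (indicator {0<..} x *\<^sub>R (1 / x)) \<partial>\<tau>)"
      unfolding set_lebesgue_integral_def by (rule integral_eq_nn_integral) (auto simp: indicator_def)
    also have "(\<integral>\<^sup>+ x. ennreal (indicator {0<..} x *\<^sub>R (1 / x)) \<partial>\<tau>) = (\<integral>\<^sup>+ x\<in>{0<..}. ennreal (1 / x) \<partial>\<tau>)"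
      by (intro nn_integral_cong) (auto simp: indicator_def)
    also have "enn2real \<dots> \<le> \<gamma>"
      using levy(1,2) by (intro enn2real_leI)
    finally show "(\<integral>x\<in>{0<..}. 1 / x \<partial>\<tau>) \<le> \<gamma>" .
  qed
  have support: "msupp (\<mu> t) \<subseteq> {0..}" if ?levy "t \<ge> 0" for t
  proof -
    interpret boolean_levy_khintchine "\<mu> t" \<tau> t \<gamma> using lk that by simp
    have "AE x in \<tau>. 0 \<le> x"
      using that(1) \<tau>(2) msupp_subset_nonneg_iff by (intro AE_nonneg_if_null) blast+
    moreover have "AE x in \<tau>. x \<noteq> 0"
      using that(1) by (intro AE_I[of _ _ "{0}"]) (auto simp: \<tau>(2))
    ultimately have pos: "AE x in \<tau>. 0 < x" by eventually_elim simp
    have "(\<integral>\<^sup>+ x. ennreal (1 / x) \<partial>\<tau>) = (\<integral>\<^sup>+ x\<in>{0<..}. ennreal (1 / x) \<partial>\<tau>)"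
      using pos by (intro nn_integral_cong_AE) (auto elim!: eventually_mono)
    \<comment> \<open>A Bochner integral that does not exist counts as 0, so the inequality for
      \<open>\<gamma>\<close> has its intended meaning only once finiteness of the extended integral
      has given integrability.\<close>
    then have int: "integrable \<tau> (\<lambda>x. 1 / x)"
      using that(1) pos by (intro integrableI_nonneg) (auto elim!: eventually_mono)
    have "(\<integral>x. 1 / x \<partial>\<tau>) = (\<integral>x\<in>{0<..}. 1 / x \<partial>\<tau>)"
      unfolding set_lebesgue_integral_def
      using pos by (intro integral_cong_AE) (auto elim!: eventually_mono)
    then have "emeasure (\<mu> t) {..<0} = 0"
      using that(1) by (intro null_negatives_if_levy_measure[OF pos int]) simp
    then show ?thesis using supp that by simp
  qed
  show "(\<exists>t0>0. msupp (\<mu> t0) \<subseteq> {0..}) \<longleftrightarrow> (\<forall>t\<ge>0. msupp (\<mu> t) \<subseteq> {0..})"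
    using levy support zero_less_one by (meson less_imp_le)
  show "(\<forall>t\<ge>0. msupp (\<mu> t) \<subseteq> {0..}) \<longleftrightarrow> ?levy"
    using levy[of 1] support zero_less_one by (meson less_imp_le)
qed

subsection \<open>Semicircle laws with drift\<close>

context
  fixes q :: complex
  assumes q: "cmod q < 1"
begin

text \<open>The denominator factors as
  \<open>(1 - q * cis \<theta>) * (1 - q * cis (-\<theta>))\<close>, and each factor has modulus at
  least \<open>1 - cmod q\<close>.\<close>

lemma chebyshev_denominator_bound:
  "(1 - cmod q)\<^sup>2 \<le> cmod (1 + q\<^sup>2 - 2 * q * of_real (cos \<theta>))"
proof -
  have "1 + q\<^sup>2 - 2 * q * of_real (cos \<theta>) = (1 - q * cis \<theta>) * (1 - q * cis (- \<theta>))"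
  proof -
    have "cis \<theta> * cis (- \<theta>) = 1" by (simp add: cis_mult)
    moreover have "cis \<theta> + cis (- \<theta>) = 2 * of_real (cos \<theta>)" by (simp add: complex_eq_iff)
    moreover have "(1 - q * cis \<theta>) * (1 - q * cis (- \<theta>))
      = 1 + q\<^sup>2 * (cis \<theta> * cis (- \<theta>)) - q * (cis \<theta> + cis (- \<theta>))"
      by (simp add: algebra_simps power2_eq_square del: cis_mult)
    ultimately show ?thesis by simp
  qed
  moreover have "1 - cmod q \<le> cmod (1 - q * cis \<phi>)" for \<phi>
    using norm_triangle_ineq2[of 1 "q * cis \<phi>"] by (simp add: norm_mult)
  ultimately show ?thesis
    using q by (auto simp: norm_mult power2_eq_square intro!: mult_mono)
qed

lemma chebyshev_denominator_neq_0: "1 + q\<^sup>2 - 2 * q * of_real (cos \<theta>) \<noteq> 0"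
proof -
  have "0 < (1 - cmod q)\<^sup>2" using q by simp
  then show ?thesis using chebyshev_denominator_bound[of \<theta>] by auto
qed

text \<open>The denominator is that of the generating function of the Chebyshev polynomials of the
  second kind. Only index 1 enters the Cauchy transform of the semicircle law; the other indices are
  there for the recurrence.\<close>

definition chebyshev_integral :: "nat \<Rightarrow> complex" where
  "chebyshev_integral n =
    integral {0..pi} (\<lambda>\<theta>. of_real (sin \<theta> * sin (real n * \<theta>)) / (1 + q\<^sup>2 - 2 * q * of_real (cos \<theta>)))"

lemma continuous_on_chebyshev_integrand:
  "continuous_on A (\<lambda>\<theta>. of_real (sin \<theta> * sin (real n * \<theta>)) / (1 + q\<^sup>2 - 2 * q * of_real (cos \<theta>)))"
  using chebyshev_denominator_neq_0 by (intro continuous_intros) auto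

text \<open>Orthogonality of the sines, which supplies the right-hand side of the recurrence. Index
  \<open>n = 0\<close> is treated apart because the product-to-sum antiderivative divides by
  \<open>n\<close>.\<close>

lemma integral_sin_mult_sin:
  "((\<lambda>\<theta>. sin \<theta> * sin (real (Suc n) * \<theta>)) has_integral (if n = 0 then pi / 2 else 0)) {0..pi}"
proof (cases "n = 0")
  case True
  have "((\<lambda>\<theta>. sin \<theta> * sin \<theta>) has_integral (pi / 2 - sin pi * cos pi / 2) - (0 / 2 - sin 0 * cos 0 / 2)) {0..pi}"
  proof (rule fundamental_theorem_of_calculus)
    fix x :: real
    have "((\<lambda>\<theta>. \<theta> / 2 - sin \<theta> * cos \<theta> / 2) has_real_derivative sin x * sin x) (at x within {0..pi})"
    proof -
      have "cos x * (cos x * 2) + sin x * (sin x * 2) = 2"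
        using sin_cos_squared_add[of x] by algebra
      then show ?thesis
        by (auto intro!: derivative_eq_intros simp: field_simps)
    qed
    then show "((\<lambda>\<theta>. \<theta> / 2 - sin \<theta> * cos \<theta> / 2) has_vector_derivative sin x * sin x) (at x within {0..pi})"
      by (simp add: has_real_derivative_iff_has_vector_derivative)
  qed simp
  then show ?thesis using True by simp
next
  case False
  define F where "F \<theta> = sin (real n * \<theta>) / (2 * real n) - sin (real (n + 2) * \<theta>) / (2 * real (n + 2))" for \<theta>
  have "((\<lambda>\<theta>. sin \<theta> * sin (real (Suc n) * \<theta>)) has_integral F pi - F 0) {0..pi}"
  proof (rule fundamental_theorem_of_calculus)
    fix x :: real
    have eq: "sin x * sin (real (Suc n) * x) = cos (real n * x) / 2 - cos (real (n + 2) * x) / 2"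
    proof -
      have "real n * x = real (Suc n) * x - x" "real (n + 2) * x = real (Suc n) * x + x"
        by (simp_all add: algebra_simps)
      then show ?thesis by (simp only: cos_add cos_diff) (simp add: field_simps)
    qed
    have "(F has_real_derivative cos (real n * x) / 2 - cos (real (n + 2) * x) / 2) (at x within {0..pi})"
    proof -
      have "((\<lambda>\<theta>. sin (c * \<theta>) / (2 * c)) has_real_derivative cos (c * x) / 2) (at x within {0..pi})"
        if "c > 0" for c
        using that by (auto intro!: derivative_eq_intros)
      then show ?thesis unfolding F_def using False by (intro DERIV_diff) (simp_all only: of_nat_0_less_iff)
    qed
    then show "(F has_vector_derivative sin x * sin (real (Suc n) * x)) (at x within {0..pi})"
      unfolding eq by (simp add: has_real_derivative_iff_has_vector_derivative)
  qed simp
  moreover have "sin (real n * pi) = 0" "sin (real (n + 2) * pi) = 0"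
    by (rule sin_npi)+
  ultimately show ?thesis using False by (simp add: F_def)
qed

text \<open>Since \<open>sin ((n + 2) * \<theta>) + sin (n * \<theta>) = 2 * cos \<theta> * sin ((n
  + 1) * \<theta>)\<close>, this combination of the integrands cancels the denominator
  exactly.\<close>

lemma chebyshev_integral_recurrence:
  "(1 + q\<^sup>2) * chebyshev_integral (Suc n) - q * (chebyshev_integral (Suc (Suc n)) + chebyshev_integral n)
    = (if n = 0 then of_real (pi / 2) else 0)"
proof -
  define S where "S n \<theta> = complex_of_real (sin \<theta> * sin (real n * \<theta>)) / (1 + q\<^sup>2 - 2 * q * of_real (cos \<theta>))" for n \<theta>
  have S: "(S n has_integral chebyshev_integral n) {0..pi}" for n
    unfolding chebyshev_integral_def S_def
    by (intro integrable_integral integrable_continuous_interval continuous_on_chebyshev_integrand)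
  have "((\<lambda>\<theta>. (1 + q\<^sup>2) * S (Suc n) \<theta> - q * (S (Suc (Suc n)) \<theta> + S n \<theta>)) has_integral
    (1 + q\<^sup>2) * chebyshev_integral (Suc n) - q * (chebyshev_integral (Suc (Suc n)) + chebyshev_integral n)) {0..pi}"
    by (intro has_integral_diff has_integral_add has_integral_mult_right S)
  moreover have "(1 + q\<^sup>2) * S (Suc n) \<theta> - q * (S (Suc (Suc n)) \<theta> + S n \<theta>)
    = of_real (sin \<theta> * sin (real (Suc n) * \<theta>))" for \<theta>
  proof -
    define d where "d = 1 + q\<^sup>2 - 2 * q * of_real (cos \<theta>)"
    have d: "d \<noteq> 0" unfolding d_def by (rule chebyshev_denominator_neq_0)
    have args: "real (Suc (Suc n)) * \<theta> = real (Suc n) * \<theta> + \<theta>" "real n * \<theta> = real (Suc n) * \<theta> - \<theta>"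
      by (simp_all add: algebra_simps)
    have sum: "sin \<theta> * sin (real (Suc (Suc n)) * \<theta>) + sin \<theta> * sin (real n * \<theta>)
        = 2 * cos \<theta> * (sin \<theta> * sin (real (Suc n) * \<theta>))"
      unfolding args sin_add sin_diff by (simp add: algebra_simps)
    define X where "X = sin \<theta> * sin (real (Suc n) * \<theta>)"
    have S_eq: "S m \<theta> = of_real (sin \<theta> * sin (real m * \<theta>)) / d" for m
      by (simp only: S_def d_def)
    have "S (Suc (Suc n)) \<theta> + S n \<theta> = of_real (2 * cos \<theta> * X) / d"
      unfolding S_eq add_divide_distrib[symmetric] of_real_add[symmetric] sum X_def ..
    moreover have "S (Suc n) \<theta> = of_real X / d" unfolding S_eq X_def ..
    ultimately have "(1 + q\<^sup>2) * S (Suc n) \<theta> - q * (S (Suc (Suc n)) \<theta> + S n \<theta>)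
      = (1 + q\<^sup>2 - q * of_real (2 * cos \<theta>)) * of_real X / d"
      by (simp add: diff_divide_distrib left_diff_distrib mult.assoc)
    also have "1 + q\<^sup>2 - q * of_real (2 * cos \<theta>) = d" by (simp add: d_def)
    finally show ?thesis using d by (simp add: X_def)
  qed
  moreover have "((\<lambda>\<theta>. complex_of_real (sin \<theta> * sin (real (Suc n) * \<theta>))) has_integral
      of_real (if n = 0 then pi / 2 else 0)) {0..pi}"
    by (intro has_integral_of_real integral_sin_mult_sin)
  ultimately show ?thesis
    by (auto dest: has_integral_unique)
qed

text \<open>The recurrence has the solutions \<open>q\<^sup>n\<close> and \<open>q\<^sup>-\<^sup>n\<close>; boundedness in \<open>n\<close> excludes
  the second one, which leaves a single equation for the first integral.\<close>

lemma chebyshev_integral_1: "chebyshev_integral 1 = of_real (pi / 2)"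
proof -
  define B where "B = 1 / (1 - cmod q)\<^sup>2 * pi"
  have bound: "cmod (chebyshev_integral n) \<le> B" for n
  proof -
    have "cmod (chebyshev_integral n) \<le> 1 / (1 - cmod q)\<^sup>2 * (pi - 0)"
      unfolding chebyshev_integral_def
    proof (rule integral_bound)
      fix \<theta> :: real
      have "\<bar>sin \<theta>\<bar> * \<bar>sin (real n * \<theta>)\<bar> \<le> 1 * 1" by (intro mult_mono) auto
      then show "cmod (of_real (sin \<theta> * sin (real n * \<theta>)) / (1 + q\<^sup>2 - 2 * q * of_real (cos \<theta>)))
          \<le> 1 / (1 - cmod q)\<^sup>2"
        using chebyshev_denominator_bound[of \<theta>] q
        unfolding norm_divide by (intro frac_le) (auto simp: abs_mult norm_mult)
    qed (simp_all only: continuous_on_chebyshev_integrand pi_ge_zero)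
    then show ?thesis by (simp add: B_def)
  qed
  \<comment> \<open>This combination annihilates the solution \<open>q ^ n\<close>, so only the
    growing one could survive in \<open>D\<close>.\<close>
  define D where "D n = chebyshev_integral (Suc n) - q * chebyshev_integral n" for n
  have D_bound: "cmod (D n) \<le> B + cmod q * B" for n
    unfolding D_def using norm_triangle_ineq4[of "chebyshev_integral (Suc n)" "q * chebyshev_integral n"]
      bound[of "Suc n"] mult_left_mono[OF bound[of n], of "cmod q"] by (simp add: norm_mult)
  \<comment> \<open>The index starts at 1 because the recurrence is homogeneous only from its second
    instance on.\<close>
  have D_step: "D (Suc n) = q * D (Suc (Suc n))" for n
    using chebyshev_integral_recurrence[of "Suc n"] by (simp add: D_def algebra_simps power2_eq_square)
  have D_eq: "D 1 = q ^ k * D (Suc k)" for k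
  proof (induction k)
    case (Suc k)
    then show ?case using D_step[of k] by (metis power_Suc2 mult.assoc)
  qed simp
  have "cmod (D 1) \<le> cmod q ^ k * (B + cmod q * B)" for k
    unfolding D_eq[of k] norm_mult norm_power using D_bound[of "Suc k"] by (intro mult_left_mono) auto
  moreover have "(\<lambda>k. cmod q ^ k * (B + cmod q * B)) \<longlonglongrightarrow> 0"
    using q by (intro tendsto_mult_left_zero LIMSEQ_realpow_zero) auto
  ultimately have "cmod (D 1) \<le> 0"
    by (intro LIMSEQ_le_const[of _ 0]) auto
  then have "chebyshev_integral 2 = q * chebyshev_integral 1"
    by (simp add: D_def numeral_2_eq_2)
  \<comment> \<open>The integral of index 0 is zero, so the first instance of the recurrence reduces
    to the value of index 1 alone.\<close>
  then show ?thesis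
    using chebyshev_integral_recurrence[of 0]
    by (simp add: chebyshev_integral_def numeral_2_eq_2 power2_eq_square algebra_simps)
qed

end

section \<open>Semicircle laws as images of one angular measure\<close>

definition semicircle_angle :: "real measure" where
  "semicircle_angle = density lborel (\<lambda>\<theta>. ennreal (indicator {0..pi} \<theta> * (2 / pi * (sin \<theta>)\<^sup>2)))"

text \<open>Under the angular measure, \<open>2 * cos \<theta>\<close> follows the standard
  semicircle law. Parametrizing by the angle puts all times on one probability space and includes
  the point mass at \<open>t = 0\<close> without a case distinction.\<close>

definition drifted_semicircle :: "real \<Rightarrow> real measure" where
  "drifted_semicircle t = distr semicircle_angle borel (\<lambda>\<theta>. t + 2 * sqrt t * cos \<theta>)"

lemma sets_semicircle_angle [simp, measurable_cong]: "sets semicircle_angle = sets borel"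
  by (simp add: semicircle_angle_def)

lemma prob_space_semicircle_angle: "prob_space semicircle_angle"
proof
  have "emeasure semicircle_angle (space semicircle_angle)
    = (\<integral>\<^sup>+ \<theta>. ennreal (2 / pi * (sin \<theta>)\<^sup>2) * indicator {0..pi} \<theta> \<partial>lborel)"
    unfolding semicircle_angle_def
    by (subst emeasure_density) (auto intro!: nn_integral_cong simp: indicator_def)
  also have "\<dots> = ennreal ((pi - sin pi * cos pi) / pi - (0 - sin 0 * cos 0) / pi)"
  proof (rule nn_integral_FTC_Icc)
    fix x :: real
    show "((\<lambda>\<theta>. (\<theta> - sin \<theta> * cos \<theta>) / pi) has_real_derivative 2 / pi * (sin x)\<^sup>2) (at x)"
    proof -
      have "1 - (cos x * cos x - sin x * sin x) = 2 * (sin x * sin x)"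
        using sin_cos_squared_add[of x] by algebra
      moreover have "((\<lambda>\<theta>. (\<theta> - sin \<theta> * cos \<theta>) / pi) has_real_derivative
          (1 - (cos x * cos x - sin x * sin x)) / pi) (at x)"
        by (auto intro!: derivative_eq_intros)
      ultimately show ?thesis
        by (simp only: power2_eq_square times_divide_eq_left)
    qed
  qed auto
  finally show "emeasure semicircle_angle (space semicircle_angle) = 1" by simp
qed

interpretation semicircle_angle: prob_space semicircle_angle
  by (rule prob_space_semicircle_angle)

lemma integral_semicircle_angle:
  fixes f :: "real \<Rightarrow> 'a :: euclidean_space"
  assumes "continuous_on UNIV f"
  shows "(\<integral>\<theta>. f \<theta> \<partial>semicircle_angle) = (2 / pi) *\<^sub>R integral {0..pi} (\<lambda>\<theta>. (sin \<theta>)\<^sup>2 *\<^sub>R f \<theta>)"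
proof -
  have [measurable]: "f \<in> borel_measurable borel"
    using assms by (rule borel_measurable_continuous_onI)
  have "(\<integral>\<theta>. f \<theta> \<partial>semicircle_angle)
    = (\<integral>\<theta>. (indicator {0..pi} \<theta> * (2 / pi * (sin \<theta>)\<^sup>2)) *\<^sub>R f \<theta> \<partial>lborel)"
    unfolding semicircle_angle_def by (rule integral_density) auto
  also have "\<dots> = (\<integral>\<theta>. (2 / pi) *\<^sub>R (indicator {0..pi} \<theta> *\<^sub>R ((sin \<theta>)\<^sup>2 *\<^sub>R f \<theta>)) \<partial>lborel)"
    by (intro Bochner_Integration.integral_cong) (auto simp: mult_ac)
  also have "\<dots> = (2 / pi) *\<^sub>R (\<integral>\<theta>. indicator {0..pi} \<theta> *\<^sub>R ((sin \<theta>)\<^sup>2 *\<^sub>R f \<theta>) \<partial>lborel)"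
    by (rule integral_scaleR_right)
  also have "(\<integral>\<theta>. indicator {0..pi} \<theta> *\<^sub>R ((sin \<theta>)\<^sup>2 *\<^sub>R f \<theta>) \<partial>lborel) = integral {0..pi} (\<lambda>\<theta>. (sin \<theta>)\<^sup>2 *\<^sub>R f \<theta>)"
  proof -
    have "continuous_on {0..pi} (\<lambda>\<theta>. (sin \<theta>)\<^sup>2 *\<^sub>R f \<theta>)"
      using assms by (intro continuous_intros) (auto intro: continuous_on_subset)
    then have "set_integrable lborel {0..pi} (\<lambda>\<theta>. (sin \<theta>)\<^sup>2 *\<^sub>R f \<theta>)"
      by (rule borel_integrable_atLeastAtMost')
    then show ?thesis
      using set_borel_integral_eq_integral(2)[of "{0..pi}" "\<lambda>\<theta>. (sin \<theta>)\<^sup>2 *\<^sub>R f \<theta>"]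
      by (simp add: set_lebesgue_integral_def)
  qed
  finally show ?thesis .
qed

lemma real_distribution_drifted_semicircle: "real_distribution (drifted_semicircle t)"
  unfolding drifted_semicircle_def
  by (intro semicircle_angle.real_distribution_distr) simp

lemma drifted_semicircle_0: "drifted_semicircle 0 = return borel 0"
  unfolding drifted_semicircle_def by (simp add: semicircle_angle.distr_const)

lemma integral_drifted_semicircle:
  fixes f :: "real \<Rightarrow> 'a :: {banach, second_countable_topology}"
  assumes "f \<in> borel_measurable borel"
  shows "(\<integral>x. f x \<partial>drifted_semicircle t) = (\<integral>\<theta>. f (t + 2 * sqrt t * cos \<theta>) \<partial>semicircle_angle)"
  unfolding drifted_semicircle_def using assms by (intro integral_distr) auto

text \<open>All laws are images of one probability measure under maps that depend continuously on
  \<open>t\<close>, so dominated convergence suffices.\<close>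

lemma weakly_continuous_drifted_semicircle: "weakly_continuous_family drifted_semicircle"
  unfolding weakly_continuous_family_def
proof (intro allI impI integral_bdd_continuous_conv_imp_weak_conv real_distribution_drifted_semicircle)
  fix t :: real and s :: "nat \<Rightarrow> real" and f :: "real \<Rightarrow> real"
  assume s: "s \<longlonglongrightarrow> t" and f: "\<And>x. isCont f x" "\<And>x. \<bar>f x\<bar> \<le> 1"
  have [measurable]: "f \<in> borel_measurable borel"
    using f(1) by (intro borel_measurable_continuous_onI continuous_at_imp_continuous_on) auto
  show "(\<lambda>n. integral\<^sup>L (drifted_semicircle (s n)) f) \<longlonglongrightarrow> integral\<^sup>L (drifted_semicircle t) f"
    unfolding integral_drifted_semicircle[of f, simplified]
  proof (rule integral_dominated_convergence[where w = "\<lambda>_. 1"])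
    show "AE \<theta> in semicircle_angle. (\<lambda>n. f (s n + 2 * sqrt (s n) * cos \<theta>)) \<longlonglongrightarrow> f (t + 2 * sqrt t * cos \<theta>)"
      using f(1) s by (intro AE_I2 isCont_tendsto_compose[of _ f] tendsto_intros) auto
  qed (use f(2) in auto)
qed

text \<open>With \<open>s = sqrt t\<close> and \<open>q = s / w\<close>, the Cauchy kernel at the
  substituted point becomes \<open>1 / w\<close> times the reciprocal of
  \<open>1 + q^2 - 2 * q * cos \<theta>\<close>, and the hypothesis on \<open>w\<close> says that
  \<open>q\<close> lies in the open unit disc. The integral of index 1 then gives the value.\<close>

lemma cauchy_G_drifted_semicircle:
  assumes "t \<ge> 0" and w: "sqrt t < cmod w"
  shows "cauchy_G (drifted_semicircle t) (w + of_real t + of_real t / w) = 1 / w"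
proof (cases "t = 0")
  \<comment> \<open>At \<open>t = 0\<close> the quotient \<open>q / s\<close> used below would be
    \<open>0 / 0\<close>, so the point mass is treated directly.\<close>
  case True
  then show ?thesis
    by (simp add: drifted_semicircle_0 cauchy_G_def integral_return)
next
  case False
  define s where "s = sqrt t"
  have s: "s > 0" "of_real t = (of_real s)\<^sup>2"
    using False assms(1) by (auto simp: s_def simp flip: of_real_power)
  have w0: "w \<noteq> 0" using w assms(1) by auto
  define q where "q = of_real s / w"
  have q: "cmod q < 1" using w s w0 by (simp add: q_def norm_divide s_def)
  have q0: "q \<noteq> 0" using s w0 by (simp add: q_def)
  define d where "d \<theta> = 1 + q\<^sup>2 - 2 * q * of_real (cos \<theta>)" for \<theta>
  have d0: "d \<theta> \<noteq> 0" for \<theta> unfolding d_def using q by (rule chebyshev_denominator_neq_0)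
  have kernel: "1 / (w + of_real t + of_real t / w - of_real (t + 2 * sqrt t * cos \<theta>)) = q / of_real s * (1 / d \<theta>)" for \<theta>
  proof -
    have "w + of_real t + of_real t / w - of_real (t + 2 * sqrt t * cos \<theta>)
      = w + (of_real s)\<^sup>2 / w - 2 * of_real s * of_real (cos \<theta>)"
      by (simp only: s(2)[symmetric]) (simp add: s_def)
    also have "\<dots> = w * d \<theta>"
      using w0 by (simp add: d_def q_def field_simps power2_eq_square)
    finally show ?thesis using w0 s by (simp add: q_def)
  qed
  have cont: "continuous_on UNIV (\<lambda>\<theta>. 1 / d \<theta>)"
    using d0 unfolding d_def by (intro continuous_intros) auto
  have "cauchy_G (drifted_semicircle t) (w + of_real t + of_real t / w)
    = (\<integral>\<theta>. q / of_real s * (1 / d \<theta>) \<partial>semicircle_angle)"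
    unfolding cauchy_G_def by (subst integral_drifted_semicircle) (auto simp only: kernel, measurable)
  also have "\<dots> = q / of_real s * ((2 / pi) *\<^sub>R integral {0..pi} (\<lambda>\<theta>. (sin \<theta>)\<^sup>2 *\<^sub>R (1 / d \<theta>)))"
    by (subst integral_mult_right_zero) (simp only: integral_semicircle_angle[OF cont])
  also have "integral {0..pi} (\<lambda>\<theta>. (sin \<theta>)\<^sup>2 *\<^sub>R (1 / d \<theta>)) = chebyshev_integral q 1"
    unfolding chebyshev_integral_def[OF q] d_def by (simp add: scaleR_conv_of_real power2_eq_square)
  also have "\<dots> = of_real (pi / 2)" using q by (rule chebyshev_integral_1)
  finally show ?thesis using s by (simp add: q_def scaleR_conv_of_real)
qed

text \<open>The threshold \<open>m >= sqrt t\<close> ensures \<open>cmod w > sqrt t\<close> on the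
  cone. This makes the formula for \<open>G\<close> available and also keeps the image in the upper
  half-plane, since its imaginary part is \<open>Im w * (1 - t / (cmod w)^2)\<close>.\<close>

lemma H_right_inverse_drifted_semicircle:
  assumes "t \<ge> 0" and m: "sqrt t \<le> m" "0 < m"
  shows "H_right_inverse (drifted_semicircle t) (\<lambda>w. w + of_real t + of_real t / w) \<eta> m"
  unfolding H_right_inverse_def
proof (intro conjI ballI)
  have ne: "z \<noteq> 0" if "z \<in> cone_region \<eta> m" for z
    using that m by (auto simp: cone_region_def)
  then show "(\<lambda>w. w + of_real t + of_real t / w) holomorphic_on cone_region \<eta> m"
    by (intro holomorphic_intros) auto
  fix w assume w: "w \<in> cone_region \<eta> m"
  then have Im: "Im w > 0" "sqrt t < Im w" using m by (auto simp: cone_region_def)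
  then have norm: "sqrt t < cmod w" using abs_Im_le_cmod[of w] by linarith
  then have "(sqrt t)\<^sup>2 < (cmod w)\<^sup>2"
    using assms(1) by (intro power_strict_mono) auto
  then have "t < (cmod w)\<^sup>2" using assms(1) by simp
  moreover have "Im (w + of_real t + of_real t / w) = Im w * (1 - t / (cmod w)\<^sup>2)"
    by (simp add: Im_divide cmod_power2 algebra_simps)
  ultimately show "Im (w + of_real t + of_real t / w) > 0"
    using Im(1) assms(1) by (simp add: divide_less_eq)
  show "cauchy_H (drifted_semicircle t) (w + of_real t + of_real t / w) = w"
    unfolding cauchy_H_def cauchy_G_drifted_semicircle[OF assms(1) norm] by simp
next
  have "((\<lambda>z. of_real t / z + of_real t / z / z) \<longlongrightarrow> 0 + 0) (at_infinity :: complex filter)"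
  proof (rule tendsto_add)
    show lim: "((\<lambda>z. of_real t / z) \<longlongrightarrow> 0) (at_infinity :: complex filter)"
      by (rule tendsto_divide_0[OF tendsto_const filterlim_ident])
    show "((\<lambda>z. of_real t / z / z) \<longlongrightarrow> 0) (at_infinity :: complex filter)"
      by (rule tendsto_divide_0[OF lim filterlim_ident])
  qed
  moreover have "(w + of_real t + of_real t / w - w) / w = of_real t / w + of_real t / w / w" for w :: complex
    by (simp add: add_divide_distrib)
  ultimately show "((\<lambda>z. (z + of_real t + of_real t / z - z) / z) \<longlongrightarrow> 0)
      (at_infinity \<sqinter> principal (cone_region \<eta> m))"
    by (auto intro: tendsto_mono[OF inf_le1])
qed

text \<open>The Voiculescu transform \<open>r + r / z\<close> is additive in
  \<open>r\<close>.\<close>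

lemma free_semigroup_drifted_semicircle: "free_semigroup drifted_semicircle"
  unfolding free_semigroup_def
proof (intro conjI allI impI weakly_continuous_drifted_semicircle)
  show "prob_real (drifted_semicircle t)" for t
    unfolding prob_real_def by (rule real_distribution_drifted_semicircle)
  fix s t :: real assume st: "0 \<le> s" "0 \<le> t"
  \<comment> \<open>One threshold has to serve all three laws, so it dominates the three square
    roots; the 1 keeps it positive at time 0.\<close>
  define m where "m = 1 + sqrt s + sqrt t + sqrt (s + t)"
  define F where "F r w = w + complex_of_real r + of_real r / w" for r w
  have m: "m > 0" "sqrt s \<le> m" "sqrt t \<le> m" "sqrt (s + t) \<le> m"
    using real_sqrt_ge_zero[of s] real_sqrt_ge_zero[of t] real_sqrt_ge_zero[of "s + t"] st
    unfolding m_def by linarith+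
  have "H_right_inverse (drifted_semicircle r) (F r) 1 m" if "0 \<le> r" "sqrt r \<le> m" for r
    unfolding F_def using that m(1) by (intro H_right_inverse_drifted_semicircle)
  moreover have "voiculescu (F (s + t)) z = voiculescu (F s) z + voiculescu (F t) z" for z
    by (simp add: voiculescu_def F_def add_divide_distrib)
  ultimately show "is_free_conv (drifted_semicircle s) (drifted_semicircle t) (drifted_semicircle (s + t))"
    unfolding is_free_conv_def using st m
    by (intro exI[of _ 1] exI[of _ m] conjI exI[of _ "F s"] exI[of _ "F t"] exI[of _ "F (s + t)"]) auto
qed

section \<open>Supports at the times 4 and 1\<close>

lemma msupp_drifted_semicircle_4: "msupp (drifted_semicircle 4) \<subseteq> {0..}"
proof -
  have "(\<lambda>\<theta>. 4 + 2 * sqrt 4 * cos \<theta>) -` {..<0} = {}"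
  proof -
    \<comment> \<open>At time 4 the mean equals the radius \<open>2 * sqrt 4\<close>, so the left
      endpoint of the support is exactly 0.\<close>
    have "0 \<le> 4 + 4 * cos \<theta>" for \<theta> :: real using cos_ge_minus_one[of \<theta>] by linarith
    then show ?thesis by (simp add: vimage_def not_less)
  qed
  then have "emeasure (drifted_semicircle 4) {..<0} = 0"
    unfolding drifted_semicircle_def by (subst emeasure_distr) auto
  then show ?thesis
    by (subst msupp_subset_nonneg_iff) (auto simp: drifted_semicircle_def)
qed

text \<open>The point -1 is the left endpoint \<open>1 + 2 * cos pi\<close>. By continuity, angles
  close to \<open>pi\<close> are mapped into any given ball around it.\<close>

lemma neg_one_in_msupp_drifted_semicircle_1: "-1 \<in> msupp (drifted_semicircle 1)"
  unfolding msupp_def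
proof (intro CollectI allI impI)
  fix e :: real assume "e > 0"
  have "isCont (\<lambda>\<theta>. 1 + 2 * cos \<theta>) pi" by (intro continuous_intros)
  then obtain \<delta> where \<delta>: "\<delta> > 0" "\<And>\<theta>. \<bar>\<theta> - pi\<bar> < \<delta> \<Longrightarrow> \<bar>(1 + 2 * cos \<theta>) - (1 + 2 * cos pi)\<bar> < e"
    using \<open>e > 0\<close> unfolding continuous_at_eps_delta by (auto simp: dist_real_def)
  define A where "A = (\<lambda>\<theta>. 1 + 2 * sqrt 1 * cos \<theta>) -` ball (-1) e"
  have [measurable]: "A \<in> sets borel"
    unfolding A_def by (intro borel_open open_vimage continuous_intros) auto
  have "A \<notin> null_sets semicircle_angle"
  proof
    assume "A \<in> null_sets semicircle_angle"
    then have "AE \<theta> in lborel. \<theta> \<in> A \<longrightarrow> ennreal (indicator {0..pi} \<theta> * (2 / pi * (sin \<theta>)\<^sup>2)) = 0"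
      unfolding semicircle_angle_def by (subst (asm) null_sets_density_iff) auto
    \<comment> \<open>The angular density vanishes at \<open>pi\<close> itself, so a null preimage
      is contradicted on an open interval just to the left of \<open>pi\<close>, where the sine is
      positive.\<close>
    then have "AE \<theta> in lborel. \<theta> \<notin> {max 0 (pi - \<delta>)<..<pi}"
    proof eventually_elim
      case (elim \<theta>)
      show ?case
      proof
        assume \<theta>: "\<theta> \<in> {max 0 (pi - \<delta>)<..<pi}"
        then have "\<theta> \<in> A" using \<delta>(2)[of \<theta>] by (auto simp: A_def dist_real_def abs_minus_commute)
        moreover have "sin \<theta> > 0" using \<theta> by (intro sin_gt_zero) auto
        then have "2 / pi * (sin \<theta>)\<^sup>2 > 0" by simp
        ultimately show False using elim \<theta> by (auto simp: ennreal_eq_0_iff)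
      qed
    qed
    then have "{max 0 (pi - \<delta>)<..<pi} \<in> null_sets lborel"
      by (subst AE_iff_null_sets) auto
    then have "emeasure lborel {max 0 (pi - \<delta>)<..<pi} = 0" by auto
    then show False using \<delta>(1) by (auto simp: max_def split: if_splits)
  qed
  then have "emeasure semicircle_angle A \<noteq> 0" by (auto simp: null_sets_def)
  moreover have "emeasure (drifted_semicircle 1) (ball (-1) e) = emeasure semicircle_angle A"
    unfolding drifted_semicircle_def A_def
    by (subst emeasure_distr) (auto simp: sets_eq_imp_space_eq[OF sets_semicircle_angle])
  ultimately show "0 < emeasure (drifted_semicircle 1) (ball (-1) e)"
    by (simp add: zero_less_iff_neq_zero)
qed

theorem theorem10p2:
  shows "(\<forall>(\<mu>::real \<Rightarrow> real measure) (\<gamma>::real) (\<tau>::real measure).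
            boolean_semigroup \<mu> \<and> \<mu> 0 = return borel 0 \<and>
            finite_measure \<tau> \<and> sets \<tau> = sets borel \<and>
            (\<forall>z. Im z > 0 \<longrightarrow>
               cauchy_K (\<mu> 1) z = complex_of_real \<gamma>
                 - (\<integral>x. (1 + complex_of_real x * z) / (complex_of_real x - z) \<partial>\<tau>))
          \<longrightarrow>
            ((\<exists>t0>0. msupp (\<mu> t0) \<subseteq> {0..}) \<longleftrightarrow> (\<forall>t\<ge>0. msupp (\<mu> t) \<subseteq> {0..})) \<and>
            ((\<forall>t\<ge>0. msupp (\<mu> t) \<subseteq> {0..}) \<longleftrightarrow>
               (msupp \<tau> \<subseteq> {0..} \<and> emeasure \<tau> {0} = 0 \<and>
                (\<integral>\<^sup>+ x\<in>{0<..}. ennreal (1 / x) \<partial>\<tau>) < \<infinity> \<and>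
                \<gamma> \<ge> (\<integral>x\<in>{0<..}. 1 / x \<partial>\<tau>))))
        \<and>
        (\<exists>\<mu>::real \<Rightarrow> real measure.
            free_semigroup \<mu> \<and> \<mu> 0 = return borel 0 \<and>
            (\<exists>t0>0. msupp (\<mu> t0) \<subseteq> {0..}) \<and>
            (\<exists>t>0. \<not> msupp (\<mu> t) \<subseteq> {0..}))"
proof (intro conjI allI impI)
  fix \<mu> :: "real \<Rightarrow> real measure" and \<gamma> :: real and \<tau> :: "real measure"
  assume "boolean_semigroup \<mu> \<and> \<mu> 0 = return borel 0 \<and> finite_measure \<tau> \<and> sets \<tau> = sets borel \<and>
    (\<forall>z. Im z > 0 \<longrightarrow> cauchy_K (\<mu> 1) z = complex_of_real \<gamma>
      - (\<integral>x. (1 + complex_of_real x * z) / (complex_of_real x - z) \<partial>\<tau>))"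
  then have \<mu>: "boolean_semigroup \<mu>" "finite_measure \<tau>" "sets \<tau> = sets borel"
      "\<And>z. Im z > 0 \<Longrightarrow> cauchy_K (\<mu> 1) z = complex_of_real \<gamma> - nevanlinna \<tau> z"
    by (auto simp: nevanlinna_def)
  show "(\<exists>t0>0. msupp (\<mu> t0) \<subseteq> {0..}) \<longleftrightarrow> (\<forall>t\<ge>0. msupp (\<mu> t) \<subseteq> {0..})"
    using \<mu> by (rule boolean_semigroup_nonneg_support_iff(1))
  show "(\<forall>t\<ge>0. msupp (\<mu> t) \<subseteq> {0..}) \<longleftrightarrow>
      msupp \<tau> \<subseteq> {0..} \<and> emeasure \<tau> {0} = 0 \<and>
      (\<integral>\<^sup>+ x\<in>{0<..}. ennreal (1 / x) \<partial>\<tau>) < \<infinity> \<and> \<gamma> \<ge> (\<integral>x\<in>{0<..}. 1 / x \<partial>\<tau>)"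
    using \<mu> by (rule boolean_semigroup_nonneg_support_iff(2))
next
  have "\<not> msupp (drifted_semicircle 1) \<subseteq> {0..}"
    using neg_one_in_msupp_drifted_semicircle_1 by auto
  then show "\<exists>\<mu>. free_semigroup \<mu> \<and> \<mu> 0 = return borel 0 \<and>
      (\<exists>t0>0. msupp (\<mu> t0) \<subseteq> {0..}) \<and> (\<exists>t>0. \<not> msupp (\<mu> t) \<subseteq> {0..})"
    using free_semigroup_drifted_semicircle drifted_semicircle_0 msupp_drifted_semicircle_4
    by (intro exI[of _ drifted_semicircle] conjI exI[of _ 4] exI[of _ 1]) auto
qed

end
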